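(* Let $K$ and $K'$ be two homotopic (oriented) twisted knots. Then there exist an integer $m\ge 0$ and $a_i\in\{-1,1\}$, $b_i,p_i^{0},p_i^{1}\in\{0,1\}$ for $i=1,\dots,m$ such that $$Q^{z}_{K}(s,t)-Q^{z}_{K'}(s,t)=\sum_{i=1}^{m}2\,a_i\bigl(s^{b_i}t^{p_i^{0}}-1\bigr)\bigl(s^{b_i}t^{p_i^{1}}-1\bigr).$$
   Context: Twisted knot diagrams. An oriented twisted knot diagram $K$ is a generic immersed oriented closed curve in $\mathbb{R}^2$ with finitely many transverse double points, each marked either as a classical crossing (with over/under information) or as a virtual crossing (no over/under information), together with finitely many bars (short transverse marks) on the curve away from the double points. Diagrams are considered up to planar isotopy. $C(K)$ is the set of classical crossings and $sgn(c)=sign(c)\in\{+1,-1\}$ is the usual sign of $c\in C(K)$. A twisted knot is an equivalence class of such diagrams under the Reidemeister moves $C_1,C_2,C_3,V_1,V_2,V_3,V_4,T_1,T_2,T_3$; $Q^z$ of a twisted knot is that of any diagram representing it. Reidemeister moves. $C_1,C_2,C_3$ are the usual classical Reidemeister moves; $V_1,V_2,V_3$ are the same moves with all crossings virtual; $V_4$ moves an arc having two consecutive virtual crossings across a classical crossing. $T_1$ inserts or deletes two adjacent bars on an arc. $T_2$ slides a bar along its strand through a virtual crossing. $T_3$ replaces a classical crossing $c$ having a bar on each of its four adjacent arcs (one before and one after $c$ on each strand) by a bar-free tangle with the same end points and the same connectivity in which the two strands cross first virtually, then at one classical crossing $c'$, then again virtually; the strand that is over at $c$ is under at $c'$, and $sgn(c')=sgn(c)$.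 All orientations are allowed. Homotopy. A crossing change at $c\in C(K)$ exchanges the over and under strands at $c$ and leaves the rest of the diagram unchanged. Two twisted knots are homotopic if diagrams of them are related by a finite sequence of crossing changes and the Reidemeister moves $C_1,C_2,C_3,V_1,V_2,V_3,V_4,T_1,T_2,T_3$. Smoothing. For $c\in C(K)$, let $K_c$ be the two-component diagram obtained by the oriented smoothing at $c$, its components labelled $0$ and $1$ (which component gets which label does not affect the definitions of $ZC(K)$, $z$ and $Q^z$). Affine index. For $l\in\{0,1\}$, traverse the $l$-component of $K_c$ once along its orientation starting near $c$, and let $\gamma_1,\dots,\gamma_{k_l}$ be the sequence of classical crossings met (with repetition). Put $\epsilon_i=0$ if the traversal passes under at $\gamma_i$ and $\epsilon_i=1$ if it passes over. Then $ind^{\,l}(c,K)=\sum_{i=1}^{k_l}(-1)^{\epsilon_i}sign(\gamma_i)$. (Self-crossings of the $l$-component contribute zero, and $ind^{\,1}(c,K)=-ind^{\,0}(c,K)$.) Zero crossings. $c\in C(K)$ is a zero crossing if $ind^{\,l}(c,K)$ is even for $l=0$ or $1$ (equivalently both). $ZC(K)$ is the set of zero crossings. For $c\in ZC(K)$ the zero affine index is $zind^{\,l}(c,K)=\sum_{\gamma_i\in ZC(K)}(-1)^{\epsilon_i}sign(\gamma_i)$, the sum being over those terms of the sequence $\gamma_1,\dots,\gamma_{k_l}$ of classical crossings met along the $l$-component of $K_c$ that are zero crossings of $K$, and $z(c)\in\{0,1\}$ is the residue of $zind^{\,l}(c,K)$ mod $2$ (independent of $l$). Bar parity. For $c\in C(K)$,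 $p^l(c)\in\{0,1\}$ is the parity of the number of bars on the $l$-component of $K_c$. The polynomial. $$Q^{z}_{K}(s,t)=\sum_{c\in ZC(K)}sgn(c)\bigl(s^{z(c)}t^{p^{0}(c)}-1\bigr)\bigl(s^{z(c)}t^{p^{1}(c)}-1\bigr)+\sum_{c\in C(K)\setminus ZC(K)}sgn(c)\bigl(s\,t^{p^{0}(c)}-1\bigr)\bigl(s\,t^{p^{1}(c)}-1\bigr).$$ *)

theory Defs
  imports "HOL-Analysis.Analysis" "HOL-Computational_Algebra.Polynomial"
begin

section \<open>Twisted knot diagrams\<close>

text \<open>
  The plane is the type of complex numbers, and an oriented closed curve is a function on the
  reals of period 1.  Places on the curve are given by parameters: \<open>overs\<close> consists of the
  parameters at which the curve passes over at a classical crossing, \<open>bars\<close> of those that carry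
  a bar.  Both are sets of real numbers of period 1.  A double point is classical if exactly one
  of its two passages belongs to \<open>overs\<close>, and virtual if none does.
\<close>

record diagram =
  curve :: "real \<Rightarrow> complex"
  overs :: "real set"
  bars :: "real set"

definition cross2 :: "complex \<Rightarrow> complex \<Rightarrow> real" where
  "cross2 v w = Re v * Im w - Im v * Re w"

abbreviation velocity :: "diagram \<Rightarrow> real \<Rightarrow> complex" where
  "velocity K t \<equiv> vector_derivative (curve K) (at t)"

definition double_params :: "diagram \<Rightarrow> real set" where
  "double_params K = {s \<in> {0..<1}. \<exists>t \<in> {0..<1}. s \<noteq> t \<and> curve K s = curve K t}"

definition immersed_closed_curve :: "(real \<Rightarrow> complex) \<Rightarrow> bool" where
  "immersed_closed_curve g \<longleftrightarrow>
     (\<forall>t. g (t + 1) = g t) \<and> g C1_differentiable_on UNIV \<and>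
     (\<forall>t. vector_derivative g (at t) \<noteq> 0)"

definition twisted_diagram :: "diagram \<Rightarrow> bool" where
  "twisted_diagram K \<longleftrightarrow>
     immersed_closed_curve (curve K) \<and>
     finite (double_params K) \<and>
     (\<forall>p. card {t \<in> {0..<1}. curve K t = p} \<le> 2) \<and>
     (\<forall>s \<in> {0..<1}. \<forall>t \<in> {0..<1}. s \<noteq> t \<and> curve K s = curve K t \<longrightarrow>
        cross2 (velocity K s) (velocity K t) \<noteq> 0 \<and> \<not> (s \<in> overs K \<and> t \<in> overs K)) \<and>
     (\<forall>t. t + 1 \<in> overs K \<longleftrightarrow> t \<in> overs K) \<and>
     overs K \<inter> {0..<1} \<subseteq> double_params K \<and>
     (\<forall>t. t + 1 \<in> bars K \<longleftrightarrow> t \<in> bars K) \<and>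
     finite (bars K \<inter> {0..<1}) \<and>
     bars K \<inter> double_params K = {}"

definition classical :: "diagram \<Rightarrow> complex set" where
  "classical K = curve K ` overs K"

definition over_at :: "diagram \<Rightarrow> complex \<Rightarrow> real" where
  "over_at K c = (THE t. t \<in> {0..<1} \<and> curve K t = c \<and> t \<in> overs K)"

definition under_at :: "diagram \<Rightarrow> complex \<Rightarrow> real" where
  "under_at K c = (THE t. t \<in> {0..<1} \<and> curve K t = c \<and> t \<notin> overs K)"

text \<open>A crossing is positive if the over strand is turned counterclockwise, by less than a half
  turn, to get to the under strand.\<close>

definition sgn_crossing :: "diagram \<Rightarrow> complex \<Rightarrow> int" where
  "sgn_crossing K c =
     (if cross2 (velocity K (over_at K c)) (velocity K (under_at K c)) > 0 then 1 else -1)"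


section \<open>Planar isotopy\<close>

text \<open>A path of \<open>C\<^sup>1\<close> diffeomorphisms of the plane that starts at the identity; \<open>H' \<tau> z\<close> is the
  differential of \<open>H \<tau>\<close> at \<open>z\<close>.\<close>

definition ambient_isotopy :: "(real \<Rightarrow> complex \<Rightarrow> complex) \<Rightarrow> bool" where
  "ambient_isotopy H \<longleftrightarrow>
     H 0 = id \<and>
     (\<forall>\<tau> \<in> {0..1}. bij (H \<tau>)) \<and>
     continuous_on ({0..1} \<times> UNIV) (\<lambda>(\<tau>, z). H \<tau> z) \<and>
     (\<exists>H'. (\<forall>\<tau> \<in> {0..1}. \<forall>z. (H \<tau> has_derivative H' \<tau> z) (at z) \<and> bij (H' \<tau> z)) \<and>
           (\<forall>v. continuous_on ({0..1} \<times> UNIV) (\<lambda>(\<tau>, z). H' \<tau> z v)))"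

text \<open>Orientation preserving changes of parameter of the circle, lifted to the real line.\<close>

definition reparametrization :: "(real \<Rightarrow> real) \<Rightarrow> bool" where
  "reparametrization r \<longleftrightarrow>
     (\<forall>t. r (t + 1) = r t + 1) \<and> r C1_differentiable_on UNIV \<and> (\<forall>t. deriv r t > 0)"

definition planar_isotopic :: "diagram \<Rightarrow> diagram \<Rightarrow> bool" where
  "planar_isotopic K K' \<longleftrightarrow>
     (\<exists>H r. ambient_isotopy H \<and> reparametrization r \<and>
        curve K' = H 1 \<circ> curve K \<circ> r \<and> overs K' = r -` overs K \<and> bars K' = r -` bars K)"


section \<open>Reidemeister moves\<close>

text \<open>
  A move replaces one tangle in a disc by another one.  As planar isotopy (which includes change
  of parameter) is available as well, it is enough to describe the pictures in one fixed disc,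
  for which we take the square \<open>box2\<close>.  A strand of a tangle is parametrized by \<open>{-1..1}\<close>;
  the pair \<open>(i, u)\<close> denotes the place with parameter \<open>u\<close> on strand number \<open>i\<close>.
\<close>

record tangle =
  strands :: "(real \<Rightarrow> complex) list"
  tovers :: "(nat \<times> real) set"
  tbars :: "(nat \<times> real) set"

definition box2 :: "complex set" where
  "box2 = cbox (Complex (-1) (-1)) (Complex 1 1)"

text \<open>A placement \<open>(m, w)\<close> says where a strand lies on the knot: it occupies the parameter interval
  with midpoint \<open>m\<close> and half length \<open>\<bar>w\<bar>\<close>.  The knot runs through the strand forwards if
  \<open>w > 0\<close> and backwards if \<open>w < 0\<close>, so that each strand may be oriented in either way.\<close>

definition place :: "real \<times> real \<Rightarrow> real \<Rightarrow> real" where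
  "place P u = fst P + snd P * u"

definition occupied :: "(real \<times> real) list \<Rightarrow> real set" where
  "occupied Ps = (\<Union>P \<in> set Ps. place P ` {-1..1})"

definition placements :: "(real \<times> real) list \<Rightarrow> bool" where
  "placements Ps \<longleftrightarrow>
     (\<forall>P \<in> set Ps. snd P \<noteq> 0) \<and> occupied Ps \<subseteq> {0<..<1} \<and>
     (\<forall>i < length Ps. \<forall>j < length Ps. i \<noteq> j \<longrightarrow>
        place (Ps ! i) ` {-1..1} \<inter> place (Ps ! j) ` {-1..1} = {})"

definition meets_box_in :: "diagram \<Rightarrow> (real \<times> real) list \<Rightarrow> tangle \<Rightarrow> bool" where
  "meets_box_in K Ps T \<longleftrightarrow>
     length Ps = length (strands T) \<and>
     (\<forall>t \<in> {0..<1}. curve K t \<in> box2 \<longleftrightarrow> t \<in> occupied Ps) \<and>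
     (\<forall>i < length Ps. \<forall>u \<in> {-1..1}.
        curve K (place (Ps ! i) u) = (strands T ! i) u \<and>
        (place (Ps ! i) u \<in> overs K \<longleftrightarrow> (i, u) \<in> tovers T) \<and>
        (place (Ps ! i) u \<in> bars K \<longleftrightarrow> (i, u) \<in> tbars T))"

definition replaces :: "tangle \<Rightarrow> tangle \<Rightarrow> diagram \<Rightarrow> diagram \<Rightarrow> bool" where
  "replaces T T' K K' \<longleftrightarrow>
     (\<exists>Ps. placements Ps \<and> meets_box_in K Ps T \<and> meets_box_in K' Ps T' \<and>
        (\<forall>t \<in> {0..<1} - occupied Ps.
           curve K' t = curve K t \<and> (t \<in> overs K' \<longleftrightarrow> t \<in> overs K) \<and>
           (t \<in> bars K' \<longleftrightarrow> t \<in> bars K)))"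

text \<open>
  The pictures.  In each of the pairs, the two pictures agree to first order at the end points of
  the strands, so that replacing one by the other keeps the curve continuously differentiable.
  The parameters of the crossings are

   \<^item> \<open>kink\<close>: the strand crosses itself at \<open>-1/2\<close> and \<open>1/2\<close>;
   \<^item> \<open>bigon\<close>: the two strands cross at \<open>-1/2\<close> (on both) and at \<open>1/2\<close> (on both);
   \<^item> \<open>triangle \<delta>\<close> for \<open>\<delta> \<in> {1, -1}\<close>: strands 0 and 1 are the diagonals and cross at \<open>0\<close>;
     strand 2 passes above (\<open>\<delta> = 1\<close>) or below (\<open>\<delta> = -1\<close>) that point, it crosses strand 0 at \<open>\<delta>/2\<close> and
     strand 1 at \<open>-\<delta>/2\<close> (on both);
   \<^item> \<open>diagonals\<close>: the two strands cross at \<open>0\<close>;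
   \<^item> \<open>braid\<close>: the two strands cross at \<open>-1/sqrt 2\<close>, \<open>0\<close> and \<open>1/sqrt 2\<close> (on both).
\<close>

definition kink :: "(real \<Rightarrow> complex) list" where
  "kink = [\<lambda>u. Complex ((4 * u ^ 3 - u) / 3) (u ^ 2)]"

definition no_kink :: "(real \<Rightarrow> complex) list" where
  "no_kink = [\<lambda>u. Complex ((u + 2 * u ^ 5) / 3) (u ^ 2)]"

definition bigon :: "(real \<Rightarrow> complex) list" where
  "bigon = [\<lambda>u. Complex u ((4 * u ^ 2 - 1) / 3), \<lambda>u. Complex u (- (4 * u ^ 2 - 1) / 3)]"

definition no_bigon :: "(real \<Rightarrow> complex) list" where
  "no_bigon = [\<lambda>u. Complex u ((1 + 2 * u ^ 4) / 3), \<lambda>u. Complex u (- (1 + 2 * u ^ 4) / 3)]"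

definition diagonals :: "(real \<Rightarrow> complex) list" where
  "diagonals = [\<lambda>u. Complex u u, \<lambda>u. Complex u (- u)]"

definition triangle :: "real \<Rightarrow> (real \<Rightarrow> complex) list" where
  "triangle \<delta> = diagonals @ [\<lambda>u. Complex u (\<delta> * (8 / 9) * (1 - u ^ 2) ^ 2)]"

definition braid :: "(real \<Rightarrow> complex) list" where
  "braid = [\<lambda>u. Complex u (u * (1 - 4 * (1 - u ^ 2) ^ 2)),
            \<lambda>u. Complex u (- (u * (1 - 4 * (1 - u ^ 2) ^ 2)))]"

definition line :: "(real \<Rightarrow> complex) list" where
  "line = [\<lambda>u. Complex u 0]"

text \<open>The over passages of \<open>triangle \<delta>\<close> if strand \<open>i\<close> runs at height \<open>h i\<close>.\<close>

definition triangle_overs :: "(nat \<Rightarrow> nat) \<Rightarrow> real \<Rightarrow> (nat \<times> real) set" where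
  "triangle_overs h \<delta> =
     {(if h 0 > h 1 then 0 else 1, 0),
      (if h 0 > h 2 then 0 else 2, \<delta> / 2),
      (if h 1 > h 2 then 1 else 2, - \<delta> / 2)}"

abbreviation tangle_of ::
  "(real \<Rightarrow> complex) list \<Rightarrow> (nat \<times> real) set \<Rightarrow> (nat \<times> real) set \<Rightarrow> tangle" where
  "tangle_of S O' B \<equiv> \<lparr>strands = S, tovers = O', tbars = B\<rparr>"

text \<open>Each move is listed in one direction only; the inverse moves enter with the equivalence closure
  below.  In \<open>T3\<close> the over and under strands are exchanged, and as the braid reverses the direction
  in which the strands cross at its middle point, the sign of the crossing is kept.\<close>

inductive move :: "diagram \<Rightarrow> diagram \<Rightarrow> bool" where
  isotopy: "planar_isotopic K K' \<Longrightarrow> move K K'"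
| C1: "v \<in> {-1/2, 1/2} \<Longrightarrow>
    replaces (tangle_of kink {(0, v)} {}) (tangle_of no_kink {} {}) K K' \<Longrightarrow> move K K'"
| C2: "i \<in> {0, 1} \<Longrightarrow>
    replaces (tangle_of bigon {(i, -1/2), (i, 1/2)} {}) (tangle_of no_bigon {} {}) K K' \<Longrightarrow> move K K'"
| C3: "inj_on h {0, 1, 2} \<Longrightarrow>
    replaces (tangle_of (triangle 1) (triangle_overs h 1) {})
             (tangle_of (triangle (-1)) (triangle_overs h (-1)) {}) K K' \<Longrightarrow> move K K'"
| V1: "replaces (tangle_of kink {} {}) (tangle_of no_kink {} {}) K K' \<Longrightarrow> move K K'"
| V2: "replaces (tangle_of bigon {} {}) (tangle_of no_bigon {} {}) K K' \<Longrightarrow> move K K'"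
| V3: "replaces (tangle_of (triangle 1) {} {}) (tangle_of (triangle (-1)) {} {}) K K' \<Longrightarrow> move K K'"
| V4: "i \<in> {0, 1} \<Longrightarrow>
    replaces (tangle_of (triangle 1) {(i, 0)} {}) (tangle_of (triangle (-1)) {(i, 0)} {}) K K' \<Longrightarrow>
    move K K'"
| T1: "replaces (tangle_of line {} {}) (tangle_of line {} {(0, -1/2), (0, 1/2)}) K K' \<Longrightarrow> move K K'"
| T2: "i \<in> {0, 1} \<Longrightarrow>
    replaces (tangle_of diagonals {} {(i, -1/2)}) (tangle_of diagonals {} {(i, 1/2)}) K K' \<Longrightarrow>
    move K K'"
| T3: "i \<in> {0, 1} \<Longrightarrow>
    replaces (tangle_of diagonals {(i, 0)} ({0, 1} \<times> {-1/2, 1/2}))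
             (tangle_of braid {(1 - i, 0)} {}) K K' \<Longrightarrow> move K K'"

definition reidemeister :: "diagram \<Rightarrow> diagram \<Rightarrow> bool" where
  "reidemeister K K' \<longleftrightarrow> twisted_diagram K \<and> twisted_diagram K' \<and> move K K'"

definition crossing_change :: "diagram \<Rightarrow> diagram \<Rightarrow> bool" where
  "crossing_change K K' \<longleftrightarrow> twisted_diagram K \<and> twisted_diagram K' \<and>
     (\<exists>c \<in> classical K. curve K' = curve K \<and> bars K' = bars K \<and>
        overs K' = {t. if curve K t = c then t \<notin> overs K else t \<in> overs K})"


section \<open>Twisted knots and homotopy\<close>

definition twisted_equivalence :: "(diagram \<times> diagram) set" where
  "twisted_equivalence =
     {(K, K'). twisted_diagram K \<and> twisted_diagram K' \<and> equivclp reidemeister K K'}"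

definition twisted_knots :: "diagram set set" where
  "twisted_knots = Collect twisted_diagram // twisted_equivalence"

definition homotopic_diagrams :: "diagram \<Rightarrow> diagram \<Rightarrow> bool" where
  "homotopic_diagrams = equivclp (\<lambda>K K'. reidemeister K K' \<or> crossing_change K K')"

definition homotopic_knots :: "diagram set \<Rightarrow> diagram set \<Rightarrow> bool" where
  "homotopic_knots k k' \<longleftrightarrow> (\<exists>K \<in> k. \<exists>K' \<in> k'. homotopic_diagrams K K')"


section \<open>Indices and the polynomial\<close>

text \<open>The parameters met on the way from \<open>s\<close> to \<open>t\<close>, for \<open>s\<close> and \<open>t\<close> in \<open>{0..<1}\<close>.\<close>

definition arc_params :: "real \<Rightarrow> real \<Rightarrow> real set" where
  "arc_params s t = (if s < t then {s<..<t} else {s<..<t + 1})"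

text \<open>The oriented smoothing at \<open>c\<close> joins the incoming end of either strand to the outgoing end of
  the other one, so its components are the two arcs of the curve between the two passages through
  \<open>c\<close>.  Component 0 is the one that leaves \<open>c\<close> along the over strand.\<close>

definition component_params :: "diagram \<Rightarrow> nat \<Rightarrow> complex \<Rightarrow> real set" where
  "component_params K l c =
     (if l = 0 then arc_params (over_at K c) (under_at K c)
      else arc_params (under_at K c) (over_at K c))"

definition passage_sign :: "diagram \<Rightarrow> real \<Rightarrow> int" where
  "passage_sign K u = (-1) ^ (if u \<in> overs K then 1 else 0) * sgn_crossing K (curve K u)"

definition ind :: "diagram \<Rightarrow> nat \<Rightarrow> complex \<Rightarrow> int" where
  "ind K l c = (\<Sum>u | u \<in> component_params K l c \<and> curve K u \<in> classical K. passage_sign K u)"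

definition ZC :: "diagram \<Rightarrow> complex set" where
  "ZC K = {c \<in> classical K. even (ind K 0 c) \<or> even (ind K 1 c)}"

definition zind :: "diagram \<Rightarrow> nat \<Rightarrow> complex \<Rightarrow> int" where
  "zind K l c = (\<Sum>u | u \<in> component_params K l c \<and> curve K u \<in> ZC K. passage_sign K u)"

definition z_res :: "diagram \<Rightarrow> complex \<Rightarrow> nat" where
  "z_res K c = nat (zind K 0 c mod 2)"

definition bar_parity :: "diagram \<Rightarrow> nat \<Rightarrow> complex \<Rightarrow> nat" where
  "bar_parity K l c = card (bars K \<inter> component_params K l c) mod 2"

text \<open>Integer polynomials in \<open>s\<close> and \<open>t\<close>, as polynomials in \<open>s\<close> over the polynomials in \<open>t\<close>.\<close>

definition s_var :: "int poly poly" where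
  "s_var = [:0, 1:]"

definition t_var :: "int poly poly" where
  "t_var = [:[:0, 1:]:]"

definition Qz :: "diagram \<Rightarrow> int poly poly" where
  "Qz K =
     (\<Sum>c \<in> ZC K. of_int (sgn_crossing K c) *
        (s_var ^ z_res K c * t_var ^ bar_parity K 0 c - 1) *
        (s_var ^ z_res K c * t_var ^ bar_parity K 1 c - 1)) +
     (\<Sum>c \<in> classical K - ZC K. of_int (sgn_crossing K c) *
        (s_var * t_var ^ bar_parity K 0 c - 1) *
        (s_var * t_var ^ bar_parity K 1 c - 1))"

end

theory Submission
  imports Defs "HOL-Library.Z2"
begin

text \<open>
  Modulo twice the elementary terms the signs of the crossings are irrelevant.  So \<open>Q\<^sup>z\<close> depends
  only on the unsigned chord diagram and the bars, and as indices enter through their parities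
  only, even less is needed: the graph whose vertices are the chords and whose edges are the
  linked pairs of chords, with two bar parities at each vertex.  A crossing is a zero crossing iff
  its vertex has even degree, and \<open>z\<close> is the parity of its number of even neighbours.

  A crossing change, the virtual and the bar moves do not alter the labelled graph.
  \<open>C\<^sub>1\<close> adds an isolated vertex with vanishing term, \<open>C\<^sub>2\<close> adds two vertices with equal neighbours
  and labels, which have equal terms, and \<open>C\<^sub>3\<close> toggles the three edges between three vertices
  such that every other vertex is adjacent to an even number of them.  The degrees of these three
  have an even sum; so if one of them is even, then the other two are both even or both odd, and
  toggling its edges to them does not affect its \<open>z\<close>.
\<close>


text \<open>A crossing change or a relabelling of the components swaps the two factors of a term, so
  only the unordered pair of bar parities may enter; it is encoded by one of them together with the
  parity of all bars, which is their sum. The circle is cut open at 0, and linking becomes a sum of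
  comparisons in the field with two elements. This sum is additive in both arguments, so every local
  move reduces to two facts about the intervals occupied by the strands: a point outside an interval
  compares alike with all points in it, and along an interval the order is kept or reversed as a
  whole. For \<open>C3\<close>, each strand runs through exactly two of the three crossings, so its
  contributions to a distant chord cancel, and on each strand the two crossings trade places, which
  flips one comparison per pair of crossings. For \<open>T3\<close>, each passage of the crossing
  lies between the two bars removed from its strand, and the two resulting changes cancel. The price
  of the cut is paid by planar isotopy, where moving it must be shown harmless.\<close>

text \<open>The simplifier would otherwise turn sums of bits into exclusive disjunctions and sums of
  indicators into cardinalities, out of reach of the lemmas on sums.\<close>

declare add_bit_eq_xor [simp del] mult_bit_eq_and [simp del] sum_of_bool_eq [simp del]

section \<open>Parity arithmetic in the field with two elements\<close>

lemma bit_add_self [simp]: "x + x = 0" for x :: bit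
  by (cases x) simp_all

lemma bit_add_self_left [simp]: "x + (x + y) = y" for x y :: bit
  by (simp flip: add.assoc)

lemma bit_add_eq_0_iff: "x + y = 0 \<longleftrightarrow> x = y" for x y :: bit
  by (cases x; cases y) simp_all

lemma of_int_bit_eq_0_iff: "(of_int n :: bit) = 0 \<longleftrightarrow> even n"
proof -
  have "(of_int n :: bit) = of_int (n mod 2 + 2 * (n div 2))"
    by simp
  also have "\<dots> = of_int (n mod 2)"
    by (simp only: of_int_add of_int_mult of_int_numeral bit_2_eq_0 mult_zero_left add_0_right)
  finally show ?thesis
    by (cases "even n") (auto simp: odd_iff_mod_2_eq_one even_iff_mod_2_eq_zero)
qed

lemma of_nat_bit_eq_0_iff: "(of_nat n :: bit) = 0 \<longleftrightarrow> even n"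
  using of_int_bit_eq_0_iff[of "int n"] by simp

lemma of_nat_bit_eq_1_iff: "(of_nat n :: bit) = 1 \<longleftrightarrow> odd n"
  using of_nat_bit_eq_0_iff[of n] by (cases "of_nat n :: bit") auto

lemma of_int_bit_eq_1_iff: "(of_int n :: bit) = 1 \<longleftrightarrow> odd n"
  using of_int_bit_eq_0_iff[of n] by (cases "of_int n :: bit") auto


section \<open>Twice the elementary terms\<close>

definition elem :: "bit \<Rightarrow> bit \<Rightarrow> bit \<Rightarrow> int poly poly" where
  "elem b p q =
     (s_var ^ of_bool (b = 1) * t_var ^ of_bool (p = 1) - 1) *
     (s_var ^ of_bool (b = 1) * t_var ^ of_bool (q = 1) - 1)"

lemma elem_commute: "elem b p q = elem b q p"
  by (simp add: elem_def mult.commute)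

text \<open>The first factor is 1 - 1. This removes the term of a kink, whatever bars the rest of
  the knot carries.\<close>

lemma elem_zero [simp]: "elem 0 0 q = 0"
  by (simp add: elem_def)

text \<open>The additive group generated by the terms \<open>2 * elem b p q\<close>, built one term
  at a time so that induction yields the list of coefficients that the theorem asks for.\<close>

inductive_set doubles :: "int poly poly set" where
  zero: "0 \<in> doubles"
| add: "x \<in> doubles \<Longrightarrow> x + 2 * elem b p q \<in> doubles"
| diff: "x \<in> doubles \<Longrightarrow> x - 2 * elem b p q \<in> doubles"

lemma doubles_add:
  assumes "x \<in> doubles" "y \<in> doubles"
  shows "x + y \<in> doubles"
  using assms(2,1)
proof (induction y rule: doubles.induct)
  case (add y b p q)
  then show ?case using doubles.add[of "x + y"] by (simp add: add.assoc)
next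
  case (diff y b p q)
  then show ?case using doubles.diff[of "x + y"] by (simp add: add_diff_eq)
qed simp

lemma doubles_uminus: "x \<in> doubles \<Longrightarrow> - x \<in> doubles"
proof (induction x rule: doubles.induct)
  case (add y b p q)
  then show ?case using doubles.diff[of "- y"] by simp
next
  case (diff y b p q)
  then show ?case using doubles.add[of "- y"] by simp
qed (simp add: doubles.zero)

lemma doubles_sum: "(\<And>c. c \<in> C \<Longrightarrow> f c \<in> doubles) \<Longrightarrow> sum f C \<in> doubles"
  by (induction C rule: infinite_finite_induct) (auto intro: doubles.zero doubles_add)

lemma doubles_elem: "2 * elem b p q \<in> doubles"
  using doubles.add[OF doubles.zero] by simp

text \<open>Switching the sign of a crossing costs one doubled term; this is how signs drop
  out.\<close>

lemma doubles_signed_elem: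
  assumes "e \<in> {1, -1}"
  shows "of_int e * elem b p q - elem b p q \<in> doubles"
proof -
  have "- elem b p q - elem b p q = - (2 * elem b p q)"
    by simp
  then show ?thesis
    using assms doubles_uminus[OF doubles_elem] doubles.zero by auto
qed

lemma doubles_as_sum:
  assumes "x \<in> doubles"
  shows "\<exists>(m :: nat) (a :: nat \<Rightarrow> int) (b :: nat \<Rightarrow> nat) (p0 :: nat \<Rightarrow> nat) (p1 :: nat \<Rightarrow> nat).
    (\<forall>i \<in> {1..m}. a i \<in> {-1, 1} \<and> b i \<in> {0, 1} \<and> p0 i \<in> {0, 1} \<and> p1 i \<in> {0, 1}) \<and>
    x = (\<Sum>i = 1..m. 2 * of_int (a i) * (s_var ^ b i * t_var ^ p0 i - 1) *
         (s_var ^ b i * t_var ^ p1 i - 1))"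
    (is "\<exists>m a b p0 p1. ?ok m a b p0 p1 \<and> x = ?sum m a b p0 p1")
proof -
  have step: "\<exists>m a b p0 p1. ?ok m a b p0 p1 \<and> y + of_int e * (2 * elem b' p q) = ?sum m a b p0 p1"
    if IH: "\<exists>m a b p0 p1. ?ok m a b p0 p1 \<and> y = ?sum m a b p0 p1" and e: "e \<in> {-1, 1}"
    for y e b' p q
  proof -
    from IH obtain m a b p0 p1 where ok: "?ok m a b p0 p1" and y: "y = ?sum m a b p0 p1"
      by blast
    let ?a = "a(Suc m := e)" and ?b = "b(Suc m := of_bool (b' = 1))"
    let ?p0 = "p0(Suc m := of_bool (p = 1))" and ?p1 = "p1(Suc m := of_bool (q = 1))"
    have eq: "?sum m ?a ?b ?p0 ?p1 = ?sum m a b p0 p1"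
      by (rule sum.cong) auto
    have term_eq: "of_int e * (2 * elem b' p q) = 2 * of_int e *
        (s_var ^ of_bool (b' = 1) * t_var ^ of_bool (p = 1) - 1) *
        (s_var ^ of_bool (b' = 1) * t_var ^ of_bool (q = 1) - 1)"
      by (simp only: elem_def mult_ac)
    have "?sum (Suc m) ?a ?b ?p0 ?p1 = ?sum m ?a ?b ?p0 ?p1 + of_int e * (2 * elem b' p q)"
      unfolding term_eq by simp
    then have "y + of_int e * (2 * elem b' p q) = ?sum (Suc m) ?a ?b ?p0 ?p1"
      by (simp only: eq y)
    moreover have "?ok (Suc m) ?a ?b ?p0 ?p1"
      using ok e by auto
    ultimately show ?thesis
      by blast
  qed
  show ?thesis
    using assms
  proof (induction rule: doubles.induct)
    case zero
    show ?case by (rule exI[of _ 0]) simp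
  next
    case (add y b p q)
    show ?case using step[OF add.IH, of 1 b p q] by simp
  next
    case (diff y b p q)
    show ?case using step[OF diff.IH, of "-1" b p q] by simp
  qed
qed


section \<open>Weights of graphs\<close>

definition even_vertices :: "'a set \<Rightarrow> ('a \<Rightarrow> 'a \<Rightarrow> bit) \<Rightarrow> 'a set" where
  "even_vertices C L = {c \<in> C. (\<Sum>d\<in>C. L c d) = 0}"

text \<open>The value 1 off the even vertices is the constant exponent of s in the second sum of
  \<open>Qz\<close>, so this function serves both sums.\<close>

definition exponent :: "'a set \<Rightarrow> ('a \<Rightarrow> 'a \<Rightarrow> bit) \<Rightarrow> 'a \<Rightarrow> bit" where
  "exponent C L c = (if c \<in> even_vertices C L then \<Sum>d\<in>even_vertices C L. L c d else 1)"

text \<open>\<open>P c\<close> stands for the bar parity of one component of the smoothing and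
  \<beta> for the parity of all bars, so \<open>P c + \<beta>\<close> belongs to the other
  component.\<close>

definition weight :: "'a set \<Rightarrow> ('a \<Rightarrow> 'a \<Rightarrow> bit) \<Rightarrow> ('a \<Rightarrow> bit) \<Rightarrow> bit \<Rightarrow> int poly poly" where
  "weight C L P \<beta> = (\<Sum>c\<in>C. elem (exponent C L c) (P c) (P c + \<beta>))"

lemma exponent_iso:
  assumes "bij_betw \<phi> C C'"
    and "\<And>c d. c \<in> C \<Longrightarrow> d \<in> C \<Longrightarrow> L' (\<phi> c) (\<phi> d) = L c d"
    and "c \<in> C"
  shows "exponent C' L' (\<phi> c) = exponent C L c"
proof -
  have inj: "inj_on \<phi> C" and C': "C' = \<phi> ` C"
    using assms(1) by (auto simp: bij_betw_def)
  have deg: "(\<Sum>d\<in>\<phi> ` D. L' (\<phi> c) d) = (\<Sum>d\<in>D. L c d)" if "c \<in> C" "D \<subseteq> C" for c D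
  proof -
    have "(\<Sum>d\<in>\<phi> ` D. L' (\<phi> c) d) = (\<Sum>d\<in>D. L' (\<phi> c) (\<phi> d))"
      using inj that by (simp add: sum.reindex inj_on_subset)
    then show ?thesis
      using that assms(2) by (auto intro!: sum.cong)
  qed
  have E: "even_vertices C' L' = \<phi> ` even_vertices C L"
    by (auto simp: even_vertices_def C' deg)
  have sub: "even_vertices C L \<subseteq> C"
    by (auto simp: even_vertices_def)
  have "\<phi> c \<in> even_vertices C' L' \<longleftrightarrow> c \<in> even_vertices C L"
    using inj assms(3) sub by (auto simp: E inj_on_def)
  then show ?thesis
    by (simp add: exponent_def E deg[OF assms(3) sub])
qed

text \<open>The disjunction on \<open>P'\<close> allows the two components at a vertex to be
  exchanged: the pair of parities is reversed, and \<open>elem\<close> is symmetric in it.\<close>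

lemma weight_iso:
  assumes "bij_betw \<phi> C C'"
    and "\<And>c d. c \<in> C \<Longrightarrow> d \<in> C \<Longrightarrow> L' (\<phi> c) (\<phi> d) = L c d"
    and "\<And>c. c \<in> C \<Longrightarrow> P' (\<phi> c) = P c \<or> P' (\<phi> c) = P c + \<beta>"
  shows "weight C' L' P' \<beta> = weight C L P \<beta>"
proof -
  have "weight C' L' P' \<beta> = (\<Sum>c\<in>C. elem (exponent C' L' (\<phi> c)) (P' (\<phi> c)) (P' (\<phi> c) + \<beta>))"
    unfolding weight_def using assms(1) by (rule sum.reindex_bij_betw[symmetric])
  also have "\<dots> = weight C L P \<beta>"
    unfolding weight_def
  proof (rule sum.cong)
    fix c assume c: "c \<in> C"
    show "elem (exponent C' L' (\<phi> c)) (P' (\<phi> c)) (P' (\<phi> c) + \<beta>) =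
        elem (exponent C L c) (P c) (P c + \<beta>)"
      using exponent_iso[where \<phi> = \<phi> and L' = L' and L = L, OF assms(1,2) c] assms(3)[OF c] elem_commute
      by (auto simp: add.assoc)
  qed simp
  finally show ?thesis .
qed

text \<open>The vertex \<open>e\<close> has degree 0, so it is even with exponent 0, and
  \<open>P e = 0\<close> makes its term vanish. No other vertex sees it.\<close>

lemma weight_isolated:
  assumes "finite C" "e \<notin> C" "L e e = 0" "P e = 0"
    and "\<And>c. c \<in> C \<Longrightarrow> L c e = 0" "\<And>c. c \<in> C \<Longrightarrow> L e c = 0"
  shows "weight (insert e C) L P \<beta> = weight C L P \<beta>"
proof -
  have E: "even_vertices (insert e C) L = insert e (even_vertices C L)"
    using assms by (auto simp: even_vertices_def)
  have fin: "finite (even_vertices C L)" and sub: "even_vertices C L \<subseteq> C"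
    using assms(1) by (auto simp: even_vertices_def)
  have e: "exponent (insert e C) L e = 0"
    using assms sub fin by (auto simp: exponent_def E sum.insert_if intro!: sum.neutral)
  have "exponent (insert e C) L c = exponent C L c" if "c \<in> C" for c
  proof -
    have "e \<notin> even_vertices C L"
      using assms(2) sub by auto
    then have "(\<Sum>d\<in>insert e (even_vertices C L). L c d) = (\<Sum>d\<in>even_vertices C L. L c d)"
      using fin assms(5)[OF that] by simp
    then show ?thesis
      using that assms(2) by (auto simp: exponent_def E)
  qed
  then show ?thesis
    using assms by (simp add: weight_def e)
qed

text \<open>Every other vertex sees both twins or neither, so its degree and exponent are kept. The
  twins have equal degrees, also if they are adjacent, hence equal exponents; their two equal terms
  form the doubled one.\<close>

lemma weight_twins:
  assumes "finite C" "e \<notin> C" "f \<notin> C" "e \<noteq> f"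
    and "L e e = 0" "L f f = 0" "L e f = L f e" "P e = P f"
    and "\<And>c. c \<in> C \<Longrightarrow> L c e = L c f" "\<And>c. c \<in> C \<Longrightarrow> L e c = L f c"
  shows "weight (insert e (insert f C)) L P \<beta> - weight C L P \<beta> \<in> doubles"
proof -
  let ?C = "insert e (insert f C)"
  have ef: "(\<Sum>d\<in>D. L e d) = (\<Sum>d\<in>D. L f d)" if "D \<subseteq> C" for D
    using that assms(10) by (auto intro!: sum.cong)
  have E: "even_vertices ?C L =
      (if e \<in> even_vertices ?C L then {e, f} else {}) \<union> even_vertices C L"
    using assms ef[of C] by (auto simp: even_vertices_def add.commute)
  have fin: "finite (even_vertices C L)" and sub: "even_vertices C L \<subseteq> C"
    using assms(1) by (auto simp: even_vertices_def)
  have notin: "e \<notin> even_vertices C L" "f \<notin> even_vertices C L"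
    using sub assms by auto
  have iff: "f \<in> even_vertices ?C L \<longleftrightarrow> e \<in> even_vertices ?C L"
    using assms ef[of C] by (auto simp: even_vertices_def add.commute)
  have eq: "exponent ?C L f = exponent ?C L e"
  proof (cases "e \<in> even_vertices ?C L")
    case True
    then have E': "even_vertices ?C L = insert e (insert f (even_vertices C L))"
      using E by auto
    show ?thesis
      using True iff assms(4-7) fin notin
      by (simp add: exponent_def E' ef[OF sub] add.commute)
  next
    case False
    then show ?thesis
      using iff by (simp add: exponent_def)
  qed
  have "exponent ?C L c = exponent C L c" if c: "c \<in> C" for c
  proof -
    have "c \<in> even_vertices ?C L \<longleftrightarrow> c \<in> even_vertices C L"
      using c assms by (subst E) auto
    moreover have "(\<Sum>d\<in>even_vertices ?C L. L c d) = (\<Sum>d\<in>even_vertices C L. L c d)"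
      using fin notin c assms(4,9) by (subst E) (auto simp: sum.insert_if)
    ultimately show ?thesis
      by (simp add: exponent_def)
  qed
  then have "weight ?C L P \<beta> = 2 * elem (exponent ?C L e) (P e) (P e + \<beta>) + weight C L P \<beta>"
    using assms eq by (simp add: weight_def)
  then show ?thesis
    using doubles_elem by simp
qed

text \<open>Each vertex of \<open>T\<close> has two edges toggled and the others none, so no degree
  changes parity and the set \<open>?E\<close> of even vertices survives. Only the toggled edges
  from an even vertex of \<open>T\<close> into \<open>?E \<inter> T\<close> could alter an
  exponent.\<close>

lemma exponent_triangle:
  assumes fin: "finite C" and T: "T = {x, y, z}" "x \<noteq> y" "x \<noteq> z" "y \<noteq> z" "T \<subseteq> C"
    and sym: "\<And>c d. c \<in> C \<Longrightarrow> d \<in> C \<Longrightarrow> L c d = L d c"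
    and diag: "\<And>c. c \<in> C \<Longrightarrow> L c c = 0"
    and L': "\<And>c d. c \<in> C \<Longrightarrow> d \<in> C \<Longrightarrow> L' c d = L c d + of_bool (c \<in> T \<and> d \<in> T \<and> c \<noteq> d)"
    and tri: "\<And>d. d \<in> C - T \<Longrightarrow> L x d + L y d + L z d = 0"
    and c: "c \<in> C"
  shows "exponent C L' c = exponent C L c"
proof -
  let ?E = "even_vertices C L"
  have deg: "(\<Sum>d\<in>D. L' c d) = (\<Sum>d\<in>D. L c d) + (\<Sum>d\<in>D \<inter> T. of_bool (c \<in> T \<and> c \<noteq> d))"
    if "c \<in> C" "D \<subseteq> C" for c D
  proof -
    have "(\<Sum>d\<in>D. L' c d) = (\<Sum>d\<in>D. L c d + of_bool (c \<in> T \<and> d \<in> T \<and> c \<noteq> d))"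
      using that by (auto intro!: sum.cong simp: L')
    also have "(\<Sum>d\<in>D. of_bool (c \<in> T \<and> d \<in> T \<and> c \<noteq> d)) =
        (\<Sum>d\<in>D \<inter> T. of_bool (c \<in> T \<and> c \<noteq> d) :: bit)"
      using that fin finite_subset by (intro sum.mono_neutral_cong_right) auto
    ultimately show ?thesis
      by (simp add: sum.distrib)
  qed
  have degT: "(\<Sum>d\<in>T. of_bool (c \<in> T \<and> c \<noteq> d)) = (0 :: bit)" for c
    using T(2-4) unfolding T(1) by (cases "c = x"; cases "c = y"; cases "c = z") simp_all
  have CT: "C \<inter> T = T"
    using T by auto
  have E': "even_vertices C L' = ?E"
    using deg[of _ C] degT by (auto simp: even_vertices_def CT)
  have sub: "?E \<subseteq> C"
    by (auto simp: even_vertices_def)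
  \<comment> \<open>Vertices outside \<open>T\<close> cancel by \<open>tri\<close>; inside
    \<open>T\<close> each edge is counted from both of its ends.\<close>
  have "(\<Sum>d\<in>C. L x d) + (\<Sum>d\<in>C. L y d) + (\<Sum>d\<in>C. L z d) = (\<Sum>d\<in>C. L x d + L y d + L z d)"
    by (simp add: sum.distrib)
  also have "\<dots> = (\<Sum>d\<in>T. L x d + L y d + L z d)"
    using fin T tri by (intro sum.mono_neutral_right) auto
  also have "\<dots> = 0"
    using T diag sym[of x y] sym[of x z] sym[of y z] by (simp add: add_ac)
  finally have sum0: "(\<Sum>d\<in>C. L x d) + (\<Sum>d\<in>C. L y d) + (\<Sum>d\<in>C. L z d) = 0" .
  \<comment> \<open>Three bits with sum 0 contain an even number of ones, so one or all three of the
    degrees are even.\<close>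
  have "?E \<inter> T = {x, y, z} \<or> ?E \<inter> T = {x} \<or> ?E \<inter> T = {y} \<or> ?E \<inter> T = {z}"
    if "x \<in> ?E \<or> y \<in> ?E \<or> z \<in> ?E"
    using that sum0 T by (cases "x \<in> ?E"; cases "y \<in> ?E"; cases "z \<in> ?E") (auto simp: even_vertices_def)
  note * = this
  have "(\<Sum>d\<in>?E \<inter> T. of_bool (c \<in> T \<and> c \<noteq> d)) = (0 :: bit)" if "c \<in> ?E" for c
  proof -
    consider "?E \<inter> T = {x, y, z}" | u where "?E \<inter> T = {u}" | "?E \<inter> T = {}" "c \<notin> T"
      using * \<open>c \<in> ?E\<close> T(1) by blast
    then show ?thesis
    proof cases
      case 1
      then show ?thesis
        using degT[of c] by (simp add: T(1))
    next
      case 2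
      then have "c \<in> T \<Longrightarrow> c = u"
        using \<open>c \<in> ?E\<close> by blast
      then show ?thesis
        by (cases "c \<in> T") (simp_all add: 2)
    next
      case 3
      then show ?thesis by simp
    qed
  qed
  then show ?thesis
    using c deg[OF c sub] by (simp add: exponent_def E')
qed


section \<open>The chord diagram of a twisted knot diagram\<close>

definition fiber :: "diagram \<Rightarrow> complex \<Rightarrow> real set" where
  "fiber K p = {t \<in> {0..<1}. curve K t = p}"

text \<open>A chord keeps the two parameters of a crossing but not which of them is over, so a
  crossing change cannot be seen.\<close>

definition chords :: "diagram \<Rightarrow> real set set" where
  "chords K = fiber K ` classical K"

definition base_bars :: "diagram \<Rightarrow> real set" where
  "base_bars K = bars K \<inter> {0..<1}"

text \<open>For disjoint two-element sets, \<open>lk c d = 1\<close> iff \<open>c\<close> and \<open>d\<close> separate each other on the circle.\<close>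

definition lk :: "real set \<Rightarrow> real set \<Rightarrow> bit" where
  "lk c d = (\<Sum>x\<in>c. \<Sum>y\<in>d. of_bool (x < y))"

text \<open>The diagonal is set by hand because \<open>lk c c\<close> is 1 for a two-element set:
  its two points are in order exactly once.\<close>

definition link :: "real set \<Rightarrow> real set \<Rightarrow> bit" where
  "link c d = (if c = d then 0 else lk c d)"

text \<open>\<open>lk c B\<close> is the parity of the bars between the smaller and the larger end
  of \<open>c\<close>, that is, on the component that avoids the cut.\<close>

definition chord_weight :: "real set set \<Rightarrow> real set \<Rightarrow> int poly poly" where
  "chord_weight C B = weight C link (\<lambda>c. lk c B) (of_nat (card B))"

lemma link_self [simp]: "link c c = 0"
  by (simp add: link_def)

lemma periodic_int:
  fixes f :: "real \<Rightarrow> 'a"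
  assumes "\<And>t. f (t + 1) = f t"
  shows "f (t + of_int n) = f t"
proof (induction n rule: int_induct[where k = 0])
  case (step1 i)
  then show ?case using assms[of "t + of_int i"] by (simp add: add_ac)
next
  case (step2 i)
  then show ?case using assms[of "t + of_int i - 1"] by (simp add: algebra_simps)
qed simp

lemma periodic_frac:
  fixes f :: "real \<Rightarrow> 'a"
  assumes "\<And>t. f (t + 1) = f t"
  shows "f (frac t) = f t"
  using periodic_int[where f = f, OF assms, of "frac t" "\<lfloor>t\<rfloor>"] by (simp add: frac_def)

lemma frac_mem [simp]: "frac t \<in> {0..<1}" for t :: real
  by (simp add: frac_lt_1)

context
  fixes K :: diagram
  assumes K: "twisted_diagram K"
begin

lemma curve_periodic: "curve K (t + 1) = curve K t"
  using K by (simp add: twisted_diagram_def immersed_closed_curve_def)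

lemma overs_periodic: "t + 1 \<in> overs K \<longleftrightarrow> t \<in> overs K"
  using K by (simp add: twisted_diagram_def)

lemma bars_periodic: "t + 1 \<in> bars K \<longleftrightarrow> t \<in> bars K"
  using K by (simp add: twisted_diagram_def)

lemma curve_frac: "curve K (frac t) = curve K t"
  by (rule periodic_frac) (rule curve_periodic)

lemma overs_frac: "frac t \<in> overs K \<longleftrightarrow> t \<in> overs K"
  by (rule periodic_frac[where f = "\<lambda>t. t \<in> overs K"]) (rule overs_periodic)

lemma finite_base_bars: "finite (base_bars K)"
  using K by (simp add: twisted_diagram_def base_bars_def)

lemma classical_iff: "p \<in> classical K \<longleftrightarrow> (\<exists>s\<in>{0..<1}. s \<in> overs K \<and> curve K s = p)"
proof
  assume "p \<in> classical K"
  then obtain t where "t \<in> overs K" "curve K t = p"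
    by (auto simp: classical_def)
  then show "\<exists>s\<in>{0..<1}. s \<in> overs K \<and> curve K s = p"
    using frac_mem[of t] by (intro bexI[of _ "frac t"]) (simp_all only: curve_frac overs_frac)
qed (auto simp: classical_def)

lemma finite_classical: "finite (classical K)"
proof -
  have "finite (double_params K)" "overs K \<inter> {0..<1} \<subseteq> double_params K"
    using K by (auto simp: twisted_diagram_def)
  moreover have "classical K \<subseteq> curve K ` (overs K \<inter> {0..<1})"
    using classical_iff by auto
  ultimately show ?thesis
    by (meson finite_subset finite_imageI)
qed

lemma fiber_eq_pair:
  assumes "s \<in> {0..<1}" "t \<in> {0..<1}" "s \<noteq> t" "curve K s = p" "curve K t = p"
  shows "fiber K p = {s, t}"
proof -
  have st: "{s, t} \<subseteq> fiber K p" "card {s, t} = 2"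
    using assms by (auto simp: fiber_def)
  \<comment> \<open>Finiteness has to be established: an infinite fiber would have
    \<open>card\<close> 0, which the bound 2 does not exclude.\<close>
  have "fiber K p \<subseteq> double_params K"
  proof
    fix x assume "x \<in> fiber K p"
    then show "x \<in> double_params K"
      using assms by (cases "x = s") (auto simp: fiber_def double_params_def)
  qed
  moreover have "finite (double_params K)" "card (fiber K p) \<le> 2"
    using K by (auto simp: twisted_diagram_def fiber_def)
  ultimately have "finite (fiber K p)" "card (fiber K p) \<le> card {s, t}"
    using st(2) by (auto intro: finite_subset)
  then show ?thesis
    using st(1) card_seteq by blast
qed

lemma crossing_passages:
  assumes "p \<in> classical K"
  obtains s t where "s \<in> {0..<1}" "t \<in> {0..<1}" "s \<noteq> t" "s \<in> overs K" "t \<notin> overs K"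
    "curve K s = p" "curve K t = p" "fiber K p = {s, t}" "over_at K p = s" "under_at K p = t"
proof -
  obtain s where s: "s \<in> {0..<1}" "s \<in> overs K" "curve K s = p"
    using assms classical_iff by auto
  then have "s \<in> double_params K"
    using K by (auto simp: twisted_diagram_def)
  then obtain t where t: "t \<in> {0..<1}" "s \<noteq> t" "curve K t = p"
    using s by (auto simp: double_params_def)
  have "t \<notin> overs K"
    using K s t by (auto simp: twisted_diagram_def)
  have fib: "fiber K p = {s, t}"
    using s t by (intro fiber_eq_pair)
  then have *: "u \<in> {0..<1} \<and> curve K u = p \<longleftrightarrow> u \<in> {s, t}" for u
    by (auto simp: fiber_def)
  have "over_at K p = s"
    unfolding over_at_def
    by (intro the_equality) (metis * s \<open>t \<notin> overs K\<close> insert_iff singletonD)+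
  moreover have "under_at K p = t"
    unfolding under_at_def
    by (intro the_equality) (metis * s t \<open>t \<notin> overs K\<close> insert_iff singletonD)+
  ultimately show thesis
    using that[of s t] s t \<open>t \<notin> overs K\<close> fib by simp
qed

lemma fiber_inj: "inj_on (fiber K) (classical K)"
proof (rule inj_onI)
  fix p q assume "p \<in> classical K" and eq: "fiber K p = fiber K q"
  then obtain s where "s \<in> fiber K p"
    by (elim crossing_passages) auto
  then show "p = q"
    using eq by (auto simp: fiber_def)
qed

lemma fiber_disjoint: "p \<noteq> q \<Longrightarrow> fiber K p \<inter> fiber K q = {}"
  by (auto simp: fiber_def)

lemma finite_fiber: "p \<in> classical K \<Longrightarrow> finite (fiber K p)"
  by (elim crossing_passages) simp

lemma card_fiber: "p \<in> classical K \<Longrightarrow> card (fiber K p) = 2"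
  by (elim crossing_passages) simp

lemma finite_chords: "finite (chords K)"
  by (simp add: chords_def finite_classical)

lemma chord_finite_card: "c \<in> chords K \<Longrightarrow> finite c \<and> card c = 2"
  using finite_fiber card_fiber by (auto simp: chords_def)

lemma chords_disjoint: "c \<in> chords K \<Longrightarrow> d \<in> chords K \<Longrightarrow> c \<noteq> d \<Longrightarrow> c \<inter> d = {}"
  by (auto simp: chords_def fiber_def)

lemma chord_disjoint_bars:
  assumes c: "c \<in> chords K"
  shows "c \<inter> base_bars K = {}"
proof -
  obtain p where p: "p \<in> classical K" "c = fiber K p"
    using c by (auto simp: chords_def)
  obtain s t where "s \<in> {0..<1}" "t \<in> {0..<1}" "s \<noteq> t" "curve K s = p" "curve K t = p"
    and st: "fiber K p = {s, t}"
    using crossing_passages[OF p(1)] by metis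
  then have "s \<in> double_params K" "t \<in> double_params K"
    by (auto simp: double_params_def)
  moreover have "bars K \<inter> double_params K = {}"
    using K by (simp add: twisted_diagram_def)
  ultimately show ?thesis
    unfolding p(2) st by (auto simp: base_bars_def)
qed

end

section \<open>Additivity and symmetry of linking; counting on arcs\<close>

lemma lk_Un_right:
  assumes "finite d" "finite e" "d \<inter> e = {}"
  shows "lk c (d \<union> e) = lk c d + lk c e"
  using assms by (simp add: lk_def sum.union_disjoint sum.distrib)

lemma lk_UN_right:
  assumes "finite D" "\<And>d. d \<in> D \<Longrightarrow> finite (f d)"
    and "\<And>d e. d \<in> D \<Longrightarrow> e \<in> D \<Longrightarrow> d \<noteq> e \<Longrightarrow> f d \<inter> f e = {}"
  shows "lk c (\<Union>d\<in>D. f d) = (\<Sum>d\<in>D. lk c (f d))"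
proof -
  have "lk c (\<Union>d\<in>D. f d) = (\<Sum>x\<in>c. \<Sum>d\<in>D. \<Sum>y\<in>f d. of_bool (x < y))"
    unfolding lk_def using assms by (intro sum.cong sum.UNION_disjoint) auto
  also have "\<dots> = (\<Sum>d\<in>D. lk c (f d))"
    unfolding lk_def by (rule sum.swap)
  finally show ?thesis .
qed

text \<open>Two distinct points are in order in exactly one of the two directions. For chords the
  right-hand side is 2 * 2, which gives the symmetry of \<open>link\<close>.\<close>

lemma lk_add_lk_swap:
  assumes "finite c" "finite d" "c \<inter> d = {}"
  shows "lk c d + lk d c = of_nat (card c * card d)"
proof -
  have "lk d c = (\<Sum>x\<in>c. \<Sum>y\<in>d. of_bool (y < x))"
    unfolding lk_def by (rule sum.swap)
  then have "lk c d + lk d c = (\<Sum>x\<in>c. \<Sum>y\<in>d. of_bool (x < y) + of_bool (y < x))"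
    by (simp add: lk_def sum.distrib)
  also have "\<dots> = (\<Sum>x\<in>c. \<Sum>y\<in>d. 1)"
    using assms(3) by (intro sum.cong) (auto simp: of_bool_def)
  finally show ?thesis by simp
qed

lemma link_commute:
  assumes "twisted_diagram K" "c \<in> chords K" "d \<in> chords K"
  shows "link c d = link d c"
proof (cases "c = d")
  case False
  then have "lk c d + lk d c = of_nat (card c * card d)"
    using assms chord_finite_card chords_disjoint by (intro lk_add_lk_swap) auto
  then have "lk c d + lk d c = 0"
    using chord_finite_card[OF assms(1,2)] by simp
  then show ?thesis
    using False by (simp add: link_def bit_add_eq_0_iff)
qed simp

text \<open>For \<open>s < t\<close> the bits of \<open>s < y\<close> and \<open>t < y\<close> add
  up to 1 exactly between the two points. Otherwise the arc passes the cut and consists, modulo 1,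
  of the points of \<open>Z\<close> that are not between \<open>t\<close> and \<open>s\<close>,
  whence the extra \<open>card Z\<close>.\<close>

lemma card_Int_arc_params:
  assumes st: "s \<in> {0..<1}" "t \<in> {0..<1}" "s \<noteq> t"
    and per: "\<And>u. u + 1 \<in> Y \<longleftrightarrow> u \<in> Y" and fin: "finite (Y \<inter> {0..<1})"
  defines "Z \<equiv> Y \<inter> {0..<1} - {s, t}"
  shows "(of_nat (card (Y \<inter> arc_params s t)) :: bit) =
    lk {s, t} Z + (if s < t then 0 else of_nat (card Z))"
proof -
  have finZ: "finite Z"
    using fin by (simp add: Z_def)
  have lkZ: "lk {s, t} Z = (\<Sum>y\<in>Z. of_bool (s < y) + of_bool (t < y))"
    using st by (simp add: lk_def sum.distrib)
  show ?thesis
  proof (cases "s < t")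
    case True
    have "lk {s, t} Z = (\<Sum>y\<in>Z. of_bool (s < y \<and> y < t))"
      unfolding lkZ using True by (intro sum.cong) (auto simp: Z_def of_bool_def)
    also have "\<dots> = of_nat (card (Z \<inter> {y. s < y \<and> y < t}))"
      using finZ by (simp add: sum_of_bool_eq)
    also have "Z \<inter> {y. s < y \<and> y < t} = Y \<inter> arc_params s t"
      using True st by (auto simp: Z_def arc_params_def)
    finally show ?thesis
      using True by simp
  next
    case False
    have "lk {s, t} Z + of_nat (card Z) = (\<Sum>y\<in>Z. of_bool (s < y) + of_bool (t < y) + 1)"
      unfolding lkZ by (simp add: sum.distrib)
    also have "\<dots> = (\<Sum>y\<in>Z. of_bool (s < y \<or> y < t))"
      using False st by (intro sum.cong) (auto simp: Z_def of_bool_def)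
    also have "\<dots> = of_nat (card (Z \<inter> {y. s < y \<or> y < t}))"
      using finZ by (simp add: sum_of_bool_eq)
    also have "card (Z \<inter> {y. s < y \<or> y < t}) = card (Y \<inter> arc_params s t)"
    proof (rule bij_betw_same_card)
      have per': "u - 1 \<in> Y \<longleftrightarrow> u \<in> Y" for u
        using per[of "u - 1"] by simp
      \<comment> \<open>Points before \<open>t\<close> are met only after the cut, where their
        parameter has grown by one period.\<close>
      show "bij_betw (\<lambda>y. if s < y then y else y + 1)
          (Z \<inter> {y. s < y \<or> y < t}) (Y \<inter> arc_params s t)"
        using False st
        by (intro bij_betw_byWitness[where f' = "\<lambda>y. if y < 1 then y else y - 1"])
          (auto simp: Z_def arc_params_def per per')
    qed
    finally show ?thesis
      using False by simp
  qed
qed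

section \<open>Indices and bar parities read off the chords\<close>

context
  fixes K :: diagram
  assumes K: "twisted_diagram K"
begin

text \<open>A chord has exactly one end on the arc iff it is linked with the chord of
  \<open>c\<close>; otherwise it counts 0 or 2. Every other chord has two ends in all, so both
  components give the same parity. The set \<open>D\<close> is \<open>classical K\<close> for
  \<open>ind\<close> and \<open>ZC K\<close> for \<open>zind\<close>.\<close>

lemma card_component_crossings:
  assumes D: "D \<subseteq> classical K" and c: "c \<in> classical K"
  shows "(of_nat (card {u \<in> component_params K l c. curve K u \<in> D}) :: bit) =
    (\<Sum>d\<in>D. link (fiber K c) (fiber K d))"
proof -
  obtain s t where st: "s \<in> {0..<1}" "t \<in> {0..<1}" "s \<noteq> t" "curve K s = c" "curve K t = c"
      "fiber K c = {s, t}" "over_at K c = s" "under_at K c = t"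
    using crossing_passages[OF K c] by metis
  let ?Y = "{u. curve K u \<in> D}"
  let ?Z = "?Y \<inter> {0..<1} - {s, t}"
  have finD: "finite D"
    using D finite_classical[OF K] finite_subset by auto
  have fin: "finite (fiber K d)" if "d \<in> D" for d
    using that D finite_fiber[OF K] by auto
  have "?Y \<inter> {0..<1} = (\<Union>d\<in>D. fiber K d)"
    by (auto simp: fiber_def)
  then have finY: "finite (?Y \<inter> {0..<1})"
    using finD fin by simp
  have Z: "?Z = (\<Union>d\<in>D - {c}. fiber K d)"
    using st(4,5) unfolding st(6)[symmetric] by (auto simp: fiber_def)
  have "card ?Z = (\<Sum>d\<in>D - {c}. card (fiber K d))"
    unfolding Z using finD fin fiber_disjoint[OF K] by (intro card_UN_disjoint) auto
  also have "\<dots> = (\<Sum>d\<in>D - {c}. 2)"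
    using D card_fiber[OF K] by (intro sum.cong) auto
  finally have card: "(of_nat (card ?Z) :: bit) = 0"
    by simp
  have "lk {s, t} ?Z = (\<Sum>d\<in>D - {c}. lk {s, t} (fiber K d))"
    unfolding Z using finD fin fiber_disjoint[OF K] by (intro lk_UN_right) auto
  also have "\<dots> = (\<Sum>d\<in>D - {c}. link (fiber K c) (fiber K d))"
  proof (intro sum.cong refl)
    fix d assume "d \<in> D - {c}"
    then have "fiber K c \<noteq> fiber K d"
      using inj_onD[OF fiber_inj[OF K], of c d] c D by blast
    then show "lk {s, t} (fiber K d) = link (fiber K c) (fiber K d)"
      by (simp add: link_def flip: st(6))
  qed
  also have "\<dots> = (\<Sum>d\<in>D. link (fiber K c) (fiber K d))"
    using finD by (intro sum.mono_neutral_left) auto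
  finally have lk: "lk {s, t} ?Z = (\<Sum>d\<in>D. link (fiber K c) (fiber K d))" .
  have swap: "{t, s} = {s, t}"
    by auto
  have "of_nat (card (?Y \<inter> arc_params s t)) = (\<Sum>d\<in>D. link (fiber K c) (fiber K d))"
    using card_Int_arc_params[OF st(1-3), of ?Y, OF _ finY] curve_periodic[OF K] card lk by simp
  moreover have "of_nat (card (?Y \<inter> arc_params t s)) = (\<Sum>d\<in>D. link (fiber K c) (fiber K d))"
    using card_Int_arc_params[OF st(2,1) st(3)[symmetric], of ?Y, OF _ finY] curve_periodic[OF K]
      card lk by (simp add: swap)
  moreover have "{u \<in> component_params K l c. curve K u \<in> D} =
      ?Y \<inter> (if l = 0 then arc_params s t else arc_params t s)"
    by (auto simp: component_params_def st(7,8))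
  ultimately show ?thesis
    by simp
qed

text \<open>Every passage counts 1 or -1, which agree modulo 2, so signs and over/under information
  leave the indices here.\<close>

lemma sum_passage_sign:
  "(of_int (\<Sum>u\<in>A. passage_sign K u) :: bit) = of_nat (card A)"
proof -
  have "(of_int (passage_sign K u) :: bit) = 1" for u
    by (simp add: passage_sign_def sgn_crossing_def)
  then show ?thesis
    by simp
qed

lemma ind_bit:
  "c \<in> classical K \<Longrightarrow> of_int (ind K l c) = (\<Sum>d\<in>classical K. link (fiber K c) (fiber K d))"
  unfolding ind_def sum_passage_sign by (rule card_component_crossings) auto

lemma ZC_eq: "ZC K = even_vertices (classical K) (\<lambda>c d. link (fiber K c) (fiber K d))"
proof -
  have "even (ind K l c) \<longleftrightarrow> (\<Sum>d\<in>classical K. link (fiber K c) (fiber K d)) = 0"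
    if "c \<in> classical K" for l c
    using of_int_bit_eq_0_iff[of "ind K l c"] ind_bit[OF that] by simp
  then show ?thesis
    by (auto simp: ZC_def even_vertices_def)
qed

lemma zind_bit:
  "c \<in> classical K \<Longrightarrow> of_int (zind K l c) = (\<Sum>d\<in>ZC K. link (fiber K c) (fiber K d))"
  unfolding zind_def sum_passage_sign by (rule card_component_crossings) (auto simp: ZC_def)

lemma z_res_eq:
  assumes "c \<in> ZC K"
  shows "z_res K c =
    of_bool (exponent (classical K) (\<lambda>c d. link (fiber K c) (fiber K d)) c = 1)"
proof -
  have "c \<in> classical K"
    using assms by (simp add: ZC_def)
  then have "exponent (classical K) (\<lambda>c d. link (fiber K c) (fiber K d)) c = of_int (zind K 0 c)"
    using assms zind_bit[of c 0] by (simp add: exponent_def flip: ZC_eq)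
  moreover have "z_res K c = of_bool (odd (zind K 0 c))"
    by (simp add: z_res_def mod2_eq_if)
  ultimately show ?thesis
    by (simp add: of_int_bit_eq_1_iff)
qed

text \<open>Which label carries \<open>p\<close> depends on whether the over or the under passage
  comes first after the cut, so the labels are only determined as a set.\<close>

lemma bar_parity_bits:
  assumes c: "c \<in> classical K"
  defines "p \<equiv> lk (fiber K c) (base_bars K)" and "\<beta> \<equiv> of_nat (card (base_bars K))"
  obtains l l' where "{l, l'} = {0, 1}"
    "bar_parity K l c = of_bool (p = 1)" "bar_parity K l' c = of_bool (p + \<beta> = 1)"
proof -
  obtain s t where st: "s \<in> {0..<1}" "t \<in> {0..<1}" "s \<noteq> t" "curve K s = c" "curve K t = c"
      "fiber K c = {s, t}" "over_at K c = s" "under_at K c = t"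
    using crossing_passages[OF K c] by metis
  have "fiber K c \<inter> base_bars K = {}"
    using chord_disjoint_bars[OF K] c by (simp add: chords_def)
  then have Z: "bars K \<inter> {0..<1} - {s, t} = base_bars K"
    unfolding st(6) by (auto simp: base_bars_def)
  have swap: "{t, s} = {s, t}"
    by auto
  have fin: "finite (bars K \<inter> {0..<1})"
    using finite_base_bars[OF K] by (simp add: base_bars_def)
  have bar: "bar_parity K l c = of_bool ((of_nat (card (bars K \<inter> component_params K l c)) :: bit) = 1)" for l
    by (simp add: bar_parity_def mod2_eq_if of_nat_bit_eq_1_iff)
  have "of_nat (card (bars K \<inter> component_params K 0 c)) = p + (if s < t then 0 else \<beta>)"
    using card_Int_arc_params[OF st(1-3) bars_periodic[OF K] fin]
    by (simp add: component_params_def st p_def \<beta>_def Z)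
  moreover have "of_nat (card (bars K \<inter> component_params K 1 c)) = p + (if t < s then 0 else \<beta>)"
    using card_Int_arc_params[OF st(2,1) st(3)[symmetric] bars_periodic[OF K] fin]
    by (simp add: component_params_def st p_def \<beta>_def Z swap)
  ultimately show thesis
    using that[of 0 1] that[of 1 0] st(3) by (cases "s < t") (auto simp: bar)
qed

lemma Qz_weight: "Qz K - chord_weight (chords K) (base_bars K) \<in> doubles"
proof -
  define L where "L = (\<lambda>c d. link (fiber K c) (fiber K d))"
  define P where "P c = lk (fiber K c) (base_bars K)" for c
  define \<beta> :: bit where "\<beta> = of_nat (card (base_bars K))"
  define E where "E c = elem (exponent (classical K) L c) (P c) (P c + \<beta>)" for c
  have ZC: "ZC K = even_vertices (classical K) L"
    by (simp add: ZC_eq L_def)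
  \<comment> \<open>The factor \<open>x\<close> is a power of \<open>s_var\<close> on
    \<open>ZC K\<close> and \<open>s_var\<close> itself elsewhere; commuting the product absorbs the
    unknown order of the components.\<close>
  have bars: "(x * t_var ^ bar_parity K 0 c - 1) * (x * t_var ^ bar_parity K 1 c - 1) =
      (x * t_var ^ of_bool (P c = 1) - 1) * (x * t_var ^ of_bool (P c + \<beta> = 1) - 1)"
    if "c \<in> classical K" for c x
    by (rule bar_parity_bits[OF that]) (auto simp: P_def \<beta>_def doubleton_eq_iff mult.commute)
  have "(\<Sum>c\<in>ZC K. of_int (sgn_crossing K c) *
        (s_var ^ z_res K c * t_var ^ bar_parity K 0 c - 1) *
        (s_var ^ z_res K c * t_var ^ bar_parity K 1 c - 1)) =
      (\<Sum>c\<in>ZC K. of_int (sgn_crossing K c) * E c)"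
    by (intro sum.cong refl) (simp add: mult.assoc E_def elem_def z_res_eq L_def bars ZC_def del: One_nat_def)
  moreover have "(\<Sum>c\<in>classical K - ZC K. of_int (sgn_crossing K c) *
        (s_var * t_var ^ bar_parity K 0 c - 1) * (s_var * t_var ^ bar_parity K 1 c - 1)) =
      (\<Sum>c\<in>classical K - ZC K. of_int (sgn_crossing K c) * E c)"
    by (intro sum.cong refl) (simp add: mult.assoc E_def elem_def exponent_def bars flip: ZC del: One_nat_def)
  ultimately have "Qz K = (\<Sum>c\<in>ZC K. of_int (sgn_crossing K c) * E c) +
      (\<Sum>c\<in>classical K - ZC K. of_int (sgn_crossing K c) * E c)"
    unfolding Qz_def by simp
  also have "\<dots> = (\<Sum>c\<in>classical K. of_int (sgn_crossing K c) * E c)"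
  proof -
    have "ZC K \<subseteq> classical K"
      by (auto simp: ZC_def)
    then show ?thesis
      by (subst sum.subset_diff[OF _ finite_classical[OF K]]) (simp_all add: add.commute)
  qed
  finally have Qz: "Qz K = (\<Sum>c\<in>classical K. of_int (sgn_crossing K c) * E c)" .
  have "chord_weight (chords K) (base_bars K) = weight (classical K) L P \<beta>"
    unfolding chord_weight_def \<beta>_def
    by (rule weight_iso[where \<phi> = "fiber K"])
      (simp_all add: chords_def bij_betw_def fiber_inj[OF K] L_def P_def)
  then have "Qz K - chord_weight (chords K) (base_bars K) =
      (\<Sum>c\<in>classical K. of_int (sgn_crossing K c) * E c - E c)"
    by (simp add: Qz weight_def E_def sum_subtractf)
  also have "\<dots> \<in> doubles"
    unfolding E_def by (intro doubles_sum doubles_signed_elem) (simp add: sgn_crossing_def)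
  finally show ?thesis .
qed

end


section \<open>Replacing a tangle\<close>

definition on_knot :: "(real \<times> real) list \<Rightarrow> nat \<times> real \<Rightarrow> real" where
  "on_knot Ps x = place (Ps ! fst x) (snd x)"

definition strand :: "(real \<times> real) list \<Rightarrow> nat \<Rightarrow> real set" where
  "strand Ps i = place (Ps ! i) ` {-1..1}"

definition on_tangle :: "tangle \<Rightarrow> nat \<times> real \<Rightarrow> bool" where
  "on_tangle T x \<longleftrightarrow> fst x < length (strands T) \<and> snd x \<in> {-1..1}"

definition crosses :: "tangle \<Rightarrow> nat \<times> real \<Rightarrow> nat \<times> real \<Rightarrow> bool" where
  "crosses T x y \<longleftrightarrow> on_tangle T x \<and> on_tangle T y \<and> x \<noteq> y \<and>
     (strands T ! fst x) (snd x) = (strands T ! fst y) (snd y)"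

text \<open>The map \<open>q\<close> sends an over passage to the other passage through the same
  crossing.\<close>

abbreviation tangle_chords ::
  "(real \<times> real) list \<Rightarrow> tangle \<Rightarrow> (nat \<times> real \<Rightarrow> nat \<times> real) \<Rightarrow> real set set" where
  "tangle_chords Ps T q \<equiv> (\<lambda>x. {on_knot Ps x, on_knot Ps (q x)}) ` tovers T"

lemma on_knot_less:
  assumes "placements Ps" "i < length Ps" "u < v"
  shows "on_knot Ps (i, u) < on_knot Ps (i, v) \<longleftrightarrow> 0 < snd (Ps ! i)"
    "on_knot Ps (i, v) < on_knot Ps (i, u) \<longleftrightarrow> \<not> 0 < snd (Ps ! i)"
proof -
  have "snd (Ps ! i) \<noteq> 0"
    using assms(1,2) by (simp add: placements_def)
  then show "on_knot Ps (i, u) < on_knot Ps (i, v) \<longleftrightarrow> 0 < snd (Ps ! i)"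
    "on_knot Ps (i, v) < on_knot Ps (i, u) \<longleftrightarrow> \<not> 0 < snd (Ps ! i)"
    using assms(3) by (auto simp: on_knot_def place_def mult_less_cancel_left)
qed

lemma strand_disjoint:
  assumes "placements Ps" "i < length Ps" "j < length Ps" "i \<noteq> j"
  shows "strand Ps i \<inter> strand Ps j = {}"
  using assms by (simp add: placements_def strand_def)

lemma on_knot_strand: "u \<in> {-1..1} \<Longrightarrow> on_knot Ps (i, u) \<in> strand Ps i"
  by (auto simp: strand_def on_knot_def)

lemma occupied_eq: "occupied Ps = (\<Union>i<length Ps. strand Ps i)"
  unfolding occupied_def strand_def set_conv_nth by blast

lemma on_knot_occupied:
  assumes "i < length Ps" "u \<in> {-1..1}"
  shows "on_knot Ps (i, u) \<in> occupied Ps"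
  using on_knot_strand[OF assms(2)] assms(1) by (auto simp: occupied_eq)

lemma occupied_on_knot:
  assumes "t \<in> occupied Ps"
  obtains i u where "i < length Ps" "u \<in> {-1..1}" "t = on_knot Ps (i, u)"
proof -
  from assms obtain i where "i < length Ps" "t \<in> strand Ps i"
    by (auto simp: occupied_eq)
  then show thesis
    using that by (auto simp: strand_def on_knot_def)
qed

lemma on_knot_eq_iff:
  assumes "placements Ps" "i < length Ps" "j < length Ps" "u \<in> {-1..1}" "v \<in> {-1..1}"
  shows "on_knot Ps (i, u) = on_knot Ps (j, v) \<longleftrightarrow> i = j \<and> u = v"
proof (cases "i = j")
  case True
  moreover have "snd (Ps ! j) \<noteq> 0"
    using assms(1,3) by (simp add: placements_def)
  ultimately show ?thesis
    by (simp add: on_knot_def place_def)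
next
  case False
  then show ?thesis
    using strand_disjoint[OF assms(1-3)] on_knot_strand[OF assms(4), of Ps i]
      on_knot_strand[OF assms(5), of Ps j] by (metis disjoint_iff)
qed

lemma occupied_subset: "placements Ps \<Longrightarrow> occupied Ps \<subseteq> {0..<1}"
  by (auto simp: placements_def)

text \<open>The strand occupies an interval, so a point outside it lies before all of it or after
  all of it.\<close>

lemma less_place_iff:
  assumes "y \<notin> place P ` {-1..1}" "u \<in> {-1..1}" "v \<in> {-1..1}"
  shows "y < place P u \<longleftrightarrow> y < place P v"
proof -
  have "connected (place P ` {-1..1})"
    unfolding place_def by (intro connected_continuous_image continuous_intros) simp
  from connected_contains_Icc[OF this] have "{place P u..place P v} \<subseteq> place P ` {-1..1}"
    "{place P v..place P u} \<subseteq> place P ` {-1..1}"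
    using assms(2,3) by auto
  then show ?thesis
    using assms(1) by (meson atLeastAtMost_iff linorder_not_less nless_le subset_iff)
qed

lemma lk_strand:
  assumes "u \<in> {-1..1}" "v \<in> {-1..1}" "d \<inter> strand Ps i = {}"
  shows "lk d {on_knot Ps (i, u)} = lk d {on_knot Ps (i, v)}"
    and "lk {on_knot Ps (i, u)} d = lk {on_knot Ps (i, v)} d"
proof -
  have *: "y < on_knot Ps (i, u) \<longleftrightarrow> y < on_knot Ps (i, v)"
    "on_knot Ps (i, u) < y \<longleftrightarrow> on_knot Ps (i, v) < y" if "y \<in> d" for y
  proof -
    have y: "y \<notin> place (Ps ! i) ` {-1..1}"
      using that assms(3) by (auto simp: strand_def)
    show *: "y < on_knot Ps (i, u) \<longleftrightarrow> y < on_knot Ps (i, v)"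
      using less_place_iff[OF y assms(1,2)] by (simp add: on_knot_def)
    have "y \<noteq> on_knot Ps (i, u)" "y \<noteq> on_knot Ps (i, v)"
      using that assms(3) on_knot_strand[OF assms(1), of Ps i] on_knot_strand[OF assms(2), of Ps i]
      by auto
    then show "on_knot Ps (i, u) < y \<longleftrightarrow> on_knot Ps (i, v) < y"
      using * by linarith
  qed
  then show "lk d {on_knot Ps (i, u)} = lk d {on_knot Ps (i, v)}"
    "lk {on_knot Ps (i, u)} d = lk {on_knot Ps (i, v)} d"
    by (auto simp: lk_def intro!: sum.cong)
qed

lemma lk_outside:
  assumes "i < length Ps" "u \<in> {-1..1}" "v \<in> {-1..1}" "d \<inter> occupied Ps = {}"
  shows "lk d {on_knot Ps (i, u)} = lk d {on_knot Ps (i, v)}"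
    and "lk {on_knot Ps (i, u)} d = lk {on_knot Ps (i, v)} d"
proof -
  have "d \<inter> strand Ps i = {}"
    using assms(1,4) by (auto simp: occupied_eq)
  from lk_strand[OF assms(2,3) this]
  show "lk d {on_knot Ps (i, u)} = lk d {on_knot Ps (i, v)}"
    "lk {on_knot Ps (i, u)} d = lk {on_knot Ps (i, v)} d" .
qed

lemma lk_other_strand:
  assumes "placements Ps" "i < length Ps" "j < length Ps" "i \<noteq> j"
    and "u \<in> {-1..1}" "u' \<in> {-1..1}" "v \<in> {-1..1}" "v' \<in> {-1..1}"
  shows "lk {on_knot Ps (i, u)} {on_knot Ps (j, v)} = lk {on_knot Ps (i, u')} {on_knot Ps (j, v')}"
proof -
  have disj: "strand Ps i \<inter> strand Ps j = {}"
    using strand_disjoint assms(1-4) .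
  have "lk {on_knot Ps (i, u)} {on_knot Ps (j, v)} = lk {on_knot Ps (i, u')} {on_knot Ps (j, v)}"
    using disj assms(5-8) on_knot_strand[of v Ps j] by (intro lk_strand(2)) auto
  also have "\<dots> = lk {on_knot Ps (i, u')} {on_knot Ps (j, v')}"
    using disj assms(5-8) on_knot_strand[of u' Ps i] by (intro lk_strand(1)) auto
  finally show ?thesis .
qed

lemma lk_insert_right:
  assumes "finite d" "y \<notin> d"
  shows "lk c (insert y d) = lk c {y} + lk c d"
  using assms by (simp add: lk_def sum.distrib)

text \<open>If one end of a chord lies on a strand, its crossing lies in \<open>box2\<close>, and
  then so do both passages: no chord is half inside. Hence a chord that meets the strands comes from
  an over passage of the picture.\<close>

lemma chords_meeting_box:
  assumes K: "twisted_diagram K" and Ps: "placements Ps" and T: "meets_box_in K Ps T"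
    and q: "\<And>x. x \<in> tovers T \<Longrightarrow> crosses T x (q x)"
  shows "chords K = {c \<in> chords K. c \<inter> occupied Ps = {}} \<union> tangle_chords Ps T q"
proof -
  have len: "length Ps = length (strands T)"
    using T by (simp add: meets_box_in_def)
  have box: "curve K t \<in> box2 \<longleftrightarrow> t \<in> occupied Ps" if "t \<in> {0..<1}" for t
    using T that by (simp add: meets_box_in_def)
  have at: "curve K (on_knot Ps x) = (strands T ! fst x) (snd x)"
    "on_knot Ps x \<in> overs K \<longleftrightarrow> x \<in> tovers T" if "on_tangle T x" for x
    using T that by (auto simp: meets_box_in_def on_tangle_def on_knot_def)
  have range: "on_knot Ps x \<in> {0..<1}" if "on_tangle T x" for x
    using that len on_knot_occupied[of "fst x" Ps "snd x"] occupied_subset[OF Ps]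
    by (auto simp: on_tangle_def)
  have fib: "fiber K (curve K (on_knot Ps x)) = {on_knot Ps x, on_knot Ps (q x)}"
    if "x \<in> tovers T" for x
  proof -
    have "crosses T x (q x)"
      using q that .
    then show ?thesis
      using on_knot_eq_iff[OF Ps, of "fst x" "fst (q x)" "snd x" "snd (q x)"] len
      by (intro fiber_eq_pair[OF K] range) (auto simp: crosses_def on_tangle_def prod_eq_iff at)
  qed
  have "c \<in> tangle_chords Ps T q" if c: "c \<in> chords K" and ne: "c \<inter> occupied Ps \<noteq> {}" for c
  proof -
    obtain p where p: "p \<in> classical K" "c = fiber K p"
      using c by (auto simp: chords_def)
    then obtain s where s: "s \<in> {0..<1}" "s \<in> overs K" "curve K s = p"
      using classical_iff[OF K] by auto
    have "p \<in> box2"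
      using ne p(2) box by (auto simp: fiber_def)
    then have "s \<in> occupied Ps"
      using box[OF s(1)] s(3) by simp
    then obtain i u where "i < length Ps" "u \<in> {-1..1}" "s = on_knot Ps (i, u)"
      by (rule occupied_on_knot)
    then have "(i, u) \<in> tovers T"
      using at(2)[of "(i, u)"] s(2) len by (simp add: on_tangle_def)
    then show ?thesis
      using fib[of "(i, u)"] p s \<open>s = on_knot Ps (i, u)\<close> by auto
  qed
  moreover have "tangle_chords Ps T q \<subseteq> chords K"
  proof
    fix c assume "c \<in> tangle_chords Ps T q"
    then obtain x where x: "x \<in> tovers T" "c = {on_knot Ps x, on_knot Ps (q x)}"
      by auto
    have "on_tangle T x"
      using q[OF x(1)] by (simp add: crosses_def)
    then have "on_knot Ps x \<in> overs K"
      using at(2) x(1) by simp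
    then have "fiber K (curve K (on_knot Ps x)) \<in> chords K"
      unfolding chords_def classical_def by (intro imageI)
    then show "c \<in> chords K"
      using fib[OF x(1)] x(2) by simp
  qed
  ultimately show ?thesis
    by blast
qed

text \<open>The crossing of a chord off \<open>A\<close> lies outside \<open>box2\<close>, so in
  both diagrams its whole fiber stays where the two agree. One inclusion suffices because the roles
  of the diagrams can be exchanged.\<close>

lemma outer_chords_subset:
  assumes K: "twisted_diagram K" "twisted_diagram K'"
    and box: "\<And>t. t \<in> {0..<1} \<Longrightarrow> curve K t \<in> box2 \<longleftrightarrow> t \<in> A"
      "\<And>t. t \<in> {0..<1} \<Longrightarrow> curve K' t \<in> box2 \<longleftrightarrow> t \<in> A"
    and eq: "\<And>t. t \<in> {0..<1} - A \<Longrightarrow> curve K' t = curve K t \<and> (t \<in> overs K' \<longleftrightarrow> t \<in> overs K)"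
  shows "{c \<in> chords K. c \<inter> A = {}} \<subseteq> {c \<in> chords K'. c \<inter> A = {}}"
proof
  fix c assume "c \<in> {c \<in> chords K. c \<inter> A = {}}"
  then obtain p where p: "p \<in> classical K" "c = fiber K p" "c \<inter> A = {}"
    by (auto simp: chords_def)
  then obtain s where s: "s \<in> {0..<1}" "s \<in> overs K" "curve K s = p"
    using classical_iff[OF K(1)] by auto
  then have "s \<notin> A"
    using p by (auto simp: fiber_def)
  then have "s \<in> overs K'" "curve K' s = p"
    using eq[of s] s by auto
  then have "p \<in> classical K'"
    unfolding classical_def by blast
  moreover have "p \<notin> box2"
    using box(1)[of s] s \<open>s \<notin> A\<close> by simp
  then have "fiber K' p = fiber K p"
    using box eq by (fastforce simp: fiber_def)
  ultimately show "c \<in> {c \<in> chords K'. c \<inter> A = {}}"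
    using p by (auto simp: chords_def)
qed

text \<open>This turns a move into combinatorics: \<open>C\<close> and \<open>B\<close> are the
  chords and bars common to both diagrams, and all else is read off the two pictures. Bars must be
  on the tangle because \<open>meets_box_in\<close> says nothing about other places.\<close>

lemma replaces_chords:
  assumes K: "twisted_diagram K" "twisted_diagram K'" and rep: "replaces T T' K K'"
    and q: "\<And>x. x \<in> tovers T \<Longrightarrow> crosses T x (q x)" "\<And>x. x \<in> tovers T' \<Longrightarrow> crosses T' x (q' x)"
    and bars: "\<And>x. x \<in> tbars T \<Longrightarrow> on_tangle T x" "\<And>x. x \<in> tbars T' \<Longrightarrow> on_tangle T' x"
  obtains Ps C B where "placements Ps" "length Ps = length (strands T)"
    "finite C" "\<forall>c\<in>C. c \<inter> occupied Ps = {}" "finite B" "B \<inter> occupied Ps = {}"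
    "chords K = C \<union> tangle_chords Ps T q" "chords K' = C \<union> tangle_chords Ps T' q'"
    "base_bars K = B \<union> on_knot Ps ` tbars T" "base_bars K' = B \<union> on_knot Ps ` tbars T'"
proof -
  obtain Ps where Ps: "placements Ps" and T: "meets_box_in K Ps T" and T': "meets_box_in K' Ps T'"
    and eq: "\<And>t. t \<in> {0..<1} - occupied Ps \<Longrightarrow> curve K' t = curve K t \<and>
      (t \<in> overs K' \<longleftrightarrow> t \<in> overs K) \<and> (t \<in> bars K' \<longleftrightarrow> t \<in> bars K)"
    using rep by (auto simp: replaces_def)
  have box: "\<And>t. t \<in> {0..<1} \<Longrightarrow> curve K t \<in> box2 \<longleftrightarrow> t \<in> occupied Ps"
    "\<And>t. t \<in> {0..<1} \<Longrightarrow> curve K' t \<in> box2 \<longleftrightarrow> t \<in> occupied Ps"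
    using T T' by (simp_all add: meets_box_in_def)
  have out: "{c \<in> chords K. c \<inter> occupied Ps = {}} = {c \<in> chords K'. c \<inter> occupied Ps = {}}"
    using eq by (intro equalityI outer_chords_subset K box) auto
  have bars_eq: "base_bars K = (base_bars K - occupied Ps) \<union> on_knot Ps ` tbars T"
    if T: "meets_box_in K Ps T" and bars: "\<And>x. x \<in> tbars T \<Longrightarrow> on_tangle T x" for K T
  proof -
    have len: "length Ps = length (strands T)"
      using T by (simp add: meets_box_in_def)
    have at: "on_knot Ps (i, u) \<in> bars K \<longleftrightarrow> (i, u) \<in> tbars T"
      if "i < length Ps" "u \<in> {-1..1}" for i u
      using T that by (auto simp: meets_box_in_def on_knot_def)
    have "t \<in> on_knot Ps ` tbars T" if t: "t \<in> base_bars K" "t \<in> occupied Ps" for t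
    proof -
      obtain i u where "i < length Ps" "u \<in> {-1..1}" "t = on_knot Ps (i, u)"
        using t(2) by (rule occupied_on_knot)
      then show ?thesis
        using at[of i u] t(1) by (auto simp: base_bars_def)
    qed
    moreover have "on_knot Ps (i, u) \<in> base_bars K" if x: "(i, u) \<in> tbars T" for i u
    proof -
      have "i < length Ps" "u \<in> {-1..1}"
        using bars[OF x] len by (auto simp: on_tangle_def)
      then show ?thesis
        using at[of i u] x on_knot_occupied[of i Ps u] occupied_subset[OF Ps]
        by (auto simp: base_bars_def)
    qed
    ultimately show ?thesis
      by auto
  qed
  have "base_bars K' - occupied Ps = base_bars K - occupied Ps"
    using eq by (auto simp: base_bars_def)
  then have bars': "base_bars K' = (base_bars K - occupied Ps) \<union> on_knot Ps ` tbars T'"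
    using bars_eq[OF T' bars(2)] by simp
  show thesis
  proof (rule that[where C = "{c \<in> chords K. c \<inter> occupied Ps = {}}" and B = "base_bars K - occupied Ps"])
    show "length Ps = length (strands T)"
      using T by (simp add: meets_box_in_def)
    show "chords K = {c \<in> chords K. c \<inter> occupied Ps = {}} \<union> tangle_chords Ps T q"
      by (rule chords_meeting_box[OF K(1) Ps T q(1)])
    show "chords K' = {c \<in> chords K. c \<inter> occupied Ps = {}} \<union> tangle_chords Ps T' q'"
      unfolding out by (rule chords_meeting_box[OF K(2) Ps T' q(2)])
    show "base_bars K = base_bars K - occupied Ps \<union> on_knot Ps ` tbars T"
      by (rule bars_eq[OF T bars(1)])
    show "base_bars K' = base_bars K - occupied Ps \<union> on_knot Ps ` tbars T'"
      by (rule bars')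
  qed (use Ps K finite_chords finite_base_bars in auto)
qed


section \<open>Effect of the moves\<close>

lemma chord_weight_bars_cong:
  assumes "\<And>c. c \<in> C \<Longrightarrow> lk c B = lk c B'" "(of_nat (card B) :: bit) = of_nat (card B')"
  shows "chord_weight C B = chord_weight C B'"
  using assms by (simp add: chord_weight_def weight_def)

lemma chord_weight_isolated:
  assumes "finite C" "e \<notin> C" "lk e B = 0"
    and "\<And>c. c \<in> C \<Longrightarrow> lk c e = 0" "\<And>c. c \<in> C \<Longrightarrow> lk e c = 0"
  shows "chord_weight (insert e C) B = chord_weight C B"
  unfolding chord_weight_def using assms
  by (intro weight_isolated) (auto simp: link_def)

lemma chord_weight_twins:
  assumes "finite C" "e \<notin> C" "f \<notin> C" "e \<noteq> f" "lk e f = lk f e" "lk e B = lk f B"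
    and "\<And>c. c \<in> C \<Longrightarrow> lk c e = lk c f" "\<And>c. c \<in> C \<Longrightarrow> lk e c = lk f c"
  shows "chord_weight (insert e (insert f C)) B - chord_weight C B \<in> doubles"
proof -
  have "c \<noteq> e" "c \<noteq> f" "e \<noteq> c" "f \<noteq> c" if "c \<in> C" for c
    using that assms(2,3) by auto
  then show ?thesis
    unfolding chord_weight_def using assms
    by (intro weight_twins) (simp_all add: link_def)
qed

text \<open>The outer conditions say that the three chords look the same from outside after the
  move, and that an outside chord is linked with an even number of them.\<close>

lemma chord_weight_triangle:
  assumes fin: "finite C" and C: "x \<notin> C" "y \<notin> C" "z \<notin> C" "x' \<notin> C" "y' \<notin> C" "z' \<notin> C"
    and ne: "x \<noteq> y" "x \<noteq> z" "y \<noteq> z" "x' \<noteq> y'" "x' \<noteq> z'" "y' \<noteq> z'"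
    and sym: "\<And>c d. c \<in> C \<union> {x, y, z} \<Longrightarrow> d \<in> C \<union> {x, y, z} \<Longrightarrow> link c d = link d c"
    and sym': "\<And>c d. c \<in> C \<union> {x', y', z'} \<Longrightarrow> d \<in> C \<union> {x', y', z'} \<Longrightarrow> link c d = link d c"
    and inner: "lk x' y' = lk x y + 1" "lk x' z' = lk x z + 1" "lk y' z' = lk y z + 1"
    and outer: "\<And>c. c \<in> C \<Longrightarrow> lk x' c = lk x c" "\<And>c. c \<in> C \<Longrightarrow> lk y' c = lk y c"
      "\<And>c. c \<in> C \<Longrightarrow> lk z' c = lk z c" "\<And>c. c \<in> C \<Longrightarrow> lk x c + lk y c + lk z c = 0"
    and bars: "lk x' B = lk x B" "lk y' B = lk y B" "lk z' B = lk z B"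
  shows "chord_weight (C \<union> {x', y', z'}) B = chord_weight (C \<union> {x, y, z}) B"
proof -
  let ?C = "C \<union> {x, y, z}" and ?C' = "C \<union> {x', y', z'}" and ?T = "{x, y, z}"
  define \<phi> where "\<phi> c = (if c = x then x' else if c = y then y' else if c = z then z' else c)" for c
  have \<phi>T: "\<phi> x = x'" "\<phi> y = y'" "\<phi> z = z'"
    using ne by (simp_all add: \<phi>_def)
  have \<phi>: "\<phi> c = c" if "c \<in> C" for c
    using that C by (auto simp: \<phi>_def)
  have CT: "c \<noteq> x" "c \<noteq> y" "c \<noteq> z" "x \<noteq> c" "y \<noteq> c" "z \<noteq> c"
    "x' \<noteq> c" "y' \<noteq> c" "z' \<noteq> c" if "c \<in> C" for c
    using that C by auto
  have bij: "bij_betw \<phi> ?C ?C'"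
    unfolding bij_betw_def
  proof
    show "inj_on \<phi> ?C"
      using C ne by (intro inj_onI) (auto simp: \<phi>_def split: if_splits)
    have "\<phi> ` C = C"
      using \<phi> by simp
    then show "\<phi> ` ?C = ?C'"
      unfolding image_Un by (simp add: \<phi>T)
  qed
  \<comment> \<open>The graph after the move, pulled back to the old chords, so that
    \<open>exponent_triangle\<close> can compare two graphs on one vertex set.\<close>
  define L' where "L' c d = link (\<phi> c) (\<phi> d)" for c d
  have "\<phi> c \<in> ?C'" if "c \<in> ?C" for c
    using bij_betwE[OF bij] that by blast
  then have L'_sym: "L' c d = L' d c" if "c \<in> ?C" "d \<in> ?C" for c d
    unfolding L'_def using that by (intro sym')
  have L'_out: "L' c d = link c d" if "c = x \<or> c = y \<or> c = z" and d: "d \<in> C" for c d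
    using that(1)
    by (elim disjE) (simp_all add: L'_def \<phi>T \<phi>[OF d] link_def CT[OF d] outer(1-3)[OF d])
  have L'_in: "L' x y = link x y + 1" "L' x z = link x z + 1" "L' y z = link y z + 1"
    using ne by (simp_all add: L'_def \<phi>T link_def inner)
  have L'_in': "L' y x = link y x + 1" "L' z x = link z x + 1" "L' z y = link z y + 1"
    using L'_in L'_sym[of y x] L'_sym[of z x] L'_sym[of z y] sym[of y x] sym[of z x] sym[of z y]
    by simp_all
  have L'_diag: "L' c c = 0" for c
    by (simp add: L'_def)
  have L': "L' c d = link c d + of_bool (c \<in> ?T \<and> d \<in> ?T \<and> c \<noteq> d)" if cd: "c \<in> ?C" "d \<in> ?C" for c d
  proof -
    consider "c \<in> C" "d \<in> C" | "c = x \<or> c = y \<or> c = z" "d \<in> C"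
      | "c \<in> C" "d = x \<or> d = y \<or> d = z" | "c = x \<or> c = y \<or> c = z" "d = x \<or> d = y \<or> d = z"
      using cd by blast
    then show ?thesis
    proof cases
      case 1
      then show ?thesis
        using CT[OF 1(1)] by (simp add: L'_def \<phi>)
    next
      case 2
      then show ?thesis
        using L'_out[OF 2] CT[OF 2(2)] by simp
    next
      case 3
      then show ?thesis
        using L'_out[OF 3(2,1)] CT[OF 3(1)] L'_sym[OF cd] sym[OF cd] by simp
    next
      case 4
      then show ?thesis
        using ne by (elim disjE) (simp_all add: L'_in L'_in' L'_diag)
    qed
  qed
  have tri: "link x d + link y d + link z d = 0" if "d \<in> ?C - ?T" for d
  proof -
    have d: "d \<in> C"
      using that by blast
    show ?thesis
      using outer(4)[OF d] by (simp add: link_def CT[OF d])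
  qed
  have exp: "exponent ?C L' c = exponent ?C link c" if "c \<in> ?C" for c
    by (rule exponent_triangle[where T = ?T, OF _ refl ne(1-3) _ sym _ L' tri that])
      (use fin in auto)
  have "chord_weight ?C' B = weight ?C L' (\<lambda>c. lk (\<phi> c) B) (of_nat (card B))"
    unfolding chord_weight_def by (rule weight_iso[OF bij]) (simp_all add: L'_def)
  also have "\<dots> = chord_weight ?C B"
    unfolding chord_weight_def weight_def
  proof (rule sum.cong[OF refl])
    fix c assume c: "c \<in> ?C"
    then have "c \<in> C \<or> c = x \<or> c = y \<or> c = z"
      by blast
    then have "lk (\<phi> c) B = lk c B"
      by (elim disjE) (simp_all add: \<phi> \<phi>T bars)
    then show "elem (exponent ?C L' c) (lk (\<phi> c) B) (lk (\<phi> c) B + of_nat (card B)) =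
        elem (exponent ?C link c) (lk c B) (lk c B + of_nat (card B))"
      by (simp only: exp[OF c])
  qed
  finally show ?thesis .
qed

section \<open>Linking with chords that end on the strands\<close>

lemma lk_pair:
  assumes "x \<noteq> y"
  shows "lk {x, y} d = lk {x} d + lk {y} d" "lk d {x, y} = lk d {x} + lk d {y}"
  using assms by (simp_all add: lk_def sum.distrib)

lemma lk_same_strand:
  assumes "placements Ps" "i < length Ps" "u \<in> {-1..1}" "v \<in> {-1..1}" "u \<noteq> v" "d \<inter> occupied Ps = {}"
  shows "lk {on_knot Ps (i, u), on_knot Ps (i, v)} d = 0"
    and "lk d {on_knot Ps (i, u), on_knot Ps (i, v)} = 0"
  using lk_outside[OF assms(2-4,6)] on_knot_eq_iff[OF assms(1,2,2,3,4)] assms(5)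
  by (simp_all add: lk_pair)

lemma lk_two_strands:
  assumes "placements Ps" "i < length Ps" "j < length Ps" "i \<noteq> j" "d \<inter> occupied Ps = {}"
    and "u \<in> {-1..1}" "u' \<in> {-1..1}" "v \<in> {-1..1}" "v' \<in> {-1..1}"
  shows "lk {on_knot Ps (i, u), on_knot Ps (j, v)} d = lk {on_knot Ps (i, u'), on_knot Ps (j, v')} d"
    and "lk d {on_knot Ps (i, u), on_knot Ps (j, v)} = lk d {on_knot Ps (i, u'), on_knot Ps (j, v')}"
  using on_knot_eq_iff[OF assms(1-3)] assms(4,6-9)
    lk_outside[OF assms(2,6,7,5)] lk_outside[OF assms(3,8,9,5)]
  by (simp_all add: lk_pair)

text \<open>Of the four comparisons between two crossings that share strand \<open>i\<close>, three
  involve different strands and do not depend on the places. The fourth is between two places on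
  \<open>i\<close>, whose order is reversed.\<close>

lemma lk_exchange:
  assumes Ps: "placements Ps" and i: "i < length Ps" "j < length Ps" "k < length Ps"
      "i \<noteq> j" "i \<noteq> k" "j \<noteq> k"
    and u: "u \<in> {-1..1}" "u' \<in> {-1..1}" "w \<in> {-1..1}" "w' \<in> {-1..1}" "(u < u') \<noteq> (w < w')"
      "u \<noteq> u'" "w \<noteq> w'"
    and v: "v \<in> {-1..1}" "v' \<in> {-1..1}" "x \<in> {-1..1}" "x' \<in> {-1..1}"
  shows "lk {on_knot Ps (i, w), on_knot Ps (j, x)} {on_knot Ps (i, w'), on_knot Ps (k, x')} =
    lk {on_knot Ps (i, u), on_knot Ps (j, v)} {on_knot Ps (i, u'), on_knot Ps (k, v')} + 1"
proof -
  have split: "lk {on_knot Ps (i, u), on_knot Ps (j, v)} {on_knot Ps (i, u'), on_knot Ps (k, v')} =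
      lk {on_knot Ps (i, u)} {on_knot Ps (i, u')} + lk {on_knot Ps (j, v)} {on_knot Ps (i, u')} +
      (lk {on_knot Ps (i, u)} {on_knot Ps (k, v')} + lk {on_knot Ps (j, v)} {on_knot Ps (k, v')})"
    if "u \<in> {-1..1}" "u' \<in> {-1..1}" "v \<in> {-1..1}" "v' \<in> {-1..1}" for u u' v v'
  proof -
    have "on_knot Ps (i, u) \<noteq> on_knot Ps (j, v)" "on_knot Ps (i, u') \<noteq> on_knot Ps (k, v')"
      using on_knot_eq_iff[OF Ps] that i by simp_all
    then show ?thesis
      by (simp add: lk_pair)
  qed
  have flip: "lk {on_knot Ps (i, w)} {on_knot Ps (i, w')} = lk {on_knot Ps (i, u)} {on_knot Ps (i, u')} + 1"
  proof (cases "u < u'")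
    case True
    then have "w' < w"
      using u by auto
    then show ?thesis
      using True by (simp add: lk_def on_knot_less[OF Ps i(1)])
  next
    case False
    then have "u' < u" "w < w'"
      using u by auto
    then show ?thesis
      by (simp add: lk_def on_knot_less[OF Ps i(1)])
  qed
  have "lk {on_knot Ps (j, x)} {on_knot Ps (i, w')} = lk {on_knot Ps (j, v)} {on_knot Ps (i, u')}"
    using i u v by (intro lk_other_strand[OF Ps]) auto
  moreover have "lk {on_knot Ps (i, w)} {on_knot Ps (k, x')} = lk {on_knot Ps (i, u)} {on_knot Ps (k, v')}"
    using i u v by (intro lk_other_strand[OF Ps]) auto
  moreover have "lk {on_knot Ps (j, x)} {on_knot Ps (k, x')} = lk {on_knot Ps (j, v)} {on_knot Ps (k, v')}"
    using i u v by (intro lk_other_strand[OF Ps]) auto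
  ultimately show ?thesis
    unfolding split[OF u(3,4) v(3,4)] split[OF u(1,2) v(1,2)] by (simp add: flip add_ac)
qed

text \<open>The strands meeting at 0, \<delta>/2 and -\<delta>/2 have numbers with sum 1, 2 and 3,
  so the partner is found by subtraction.\<close>

definition triangle_partner :: "real \<Rightarrow> nat \<times> real \<Rightarrow> nat \<times> real" where
  "triangle_partner \<delta> x =
     ((if snd x = 0 then 1 else if snd x = \<delta> / 2 then 2 else 3) - fst x, snd x)"

lemma triangle_crosses:
  assumes "\<delta> \<in> {1, -1}" "x \<in> triangle_overs h \<delta>"
  shows "crosses (tangle_of (triangle \<delta>) (triangle_overs h \<delta>) {}) x (triangle_partner \<delta> x)"
proof -
  have x: "x \<in> {(0, 0), (1, 0), (0, \<delta> / 2), (2, \<delta> / 2), (1, - \<delta> / 2), (2, - \<delta> / 2)}"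
    using assms(2) by (auto simp: triangle_overs_def split: if_splits)
  have "\<delta> = 1 \<or> \<delta> = -1"
    using assms(1) by simp
  then show ?thesis
    using x unfolding insert_iff empty_iff
    by (elim disjE) (simp_all add: crosses_def on_tangle_def triangle_partner_def triangle_def
        diagonals_def power2_eq_square)
qed

text \<open>Exchanging over and under only permutes the two ends of a chord, so the heights
  \<open>h\<close> disappear.\<close>

lemma triangle_chords:
  assumes "\<delta> \<in> {1, -1}"
  shows "tangle_chords Ps (tangle_of (triangle \<delta>) (triangle_overs h \<delta>) {}) (triangle_partner \<delta>) =
    {{on_knot Ps (0, 0), on_knot Ps (1, 0)}, {on_knot Ps (0, \<delta>/2), on_knot Ps (2, \<delta>/2)},
     {on_knot Ps (1, -\<delta>/2), on_knot Ps (2, -\<delta>/2)}}"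
proof -
  define f where "f x = {on_knot Ps x, on_knot Ps (triangle_partner \<delta> x)}" for x
  have "\<delta> \<noteq> 0"
    using assms by auto
  then have "f (if h 0 > h 1 then 0 else 1, 0) = {on_knot Ps (0, 0), on_knot Ps (1, 0)}"
    "f (if h 0 > h 2 then 0 else 2, \<delta>/2) = {on_knot Ps (0, \<delta>/2), on_knot Ps (2, \<delta>/2)}"
    "f (if h 1 > h 2 then 1 else 2, -\<delta>/2) = {on_knot Ps (1, -\<delta>/2), on_knot Ps (2, -\<delta>/2)}"
    by (simp_all add: f_def triangle_partner_def insert_commute)
  then show ?thesis
    unfolding f_def[symmetric] triangle_overs_def by simp
qed

section \<open>The Reidemeister moves and the crossing change one by one\<close>

context
  fixes K K' :: diagram
  assumes K: "twisted_diagram K" and K': "twisted_diagram K'"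
begin

text \<open>Both ends of the kink chord are on one strand, and nothing outside can separate them:
  the chord is isolated, and one of its components carries no bar.\<close>

lemma C1_weight:
  assumes v: "v \<in> {-1/2, 1/2}"
    and rep: "replaces (tangle_of kink {(0, v)} {}) (tangle_of no_kink {} {}) K K'"
      (is "replaces ?T ?T' K K'")
  shows "chord_weight (chords K) (base_bars K) = chord_weight (chords K') (base_bars K')"
proof -
  have "crosses ?T x (fst x, - snd x)" if "x \<in> tovers ?T" for x
  proof -
    have "x = (0, 1 / 2) \<or> x = (0, - 1 / 2)"
      using v that by auto
    then show ?thesis
      by (elim disjE) (simp_all add: crosses_def on_tangle_def kink_def power2_eq_square power3_eq_cube)
  qed
  moreover have "crosses ?T' x (id x)" if "x \<in> tovers ?T'" for x
    using that by simp
  moreover have "on_tangle ?T x" if "x \<in> tbars ?T" for x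
    using that by simp
  moreover have "on_tangle ?T' x" if "x \<in> tbars ?T'" for x
    using that by simp
  ultimately obtain Ps C B where Ps: "placements Ps" "length Ps = length (strands ?T)"
    and C: "finite C" "\<forall>c\<in>C. c \<inter> occupied Ps = {}" and B: "finite B" "B \<inter> occupied Ps = {}"
    and eq: "chords K = C \<union> tangle_chords Ps ?T (\<lambda>x. (fst x, - snd x))"
      "chords K' = C \<union> tangle_chords Ps ?T' id"
      "base_bars K = B \<union> on_knot Ps ` tbars ?T" "base_bars K' = B \<union> on_knot Ps ` tbars ?T'"
    by (rule replaces_chords[OF K K' rep])
  have len: "0 < length Ps"
    using Ps(2) by (simp add: kink_def)
  have v': "v \<in> {-1..1}" "- v \<in> {-1..1}" "v \<noteq> - v"
    using v by auto
  define e where "e = {on_knot Ps (0, v), on_knot Ps (0, - v)}"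
  have e: "lk e d = 0" "lk d e = 0" if "d \<inter> occupied Ps = {}" for d
    unfolding e_def using lk_same_strand[OF Ps(1) len v' that] by simp_all
  have "e \<inter> occupied Ps \<noteq> {}"
    using on_knot_occupied[OF len v'(1)] by (auto simp: e_def)
  then have "e \<notin> C"
    using C(2) by blast
  then have "chord_weight (insert e C) B = chord_weight C B"
    using C B e by (intro chord_weight_isolated) auto
  then show ?thesis
    by (simp add: eq e_def)
qed

text \<open>Both chords join strand 0 to strand 1, so they look alike from outside. Whether they
  link each other depends on whether the strands run in parallel; the symmetry of
  \<open>link\<close> covers both cases.\<close>

lemma C2_weight:
  assumes i: "i \<in> {0, 1}"
    and rep: "replaces (tangle_of bigon {(i, -1/2), (i, 1/2)} {}) (tangle_of no_bigon {} {}) K K'"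
      (is "replaces ?T ?T' K K'")
  shows "chord_weight (chords K) (base_bars K) - chord_weight (chords K') (base_bars K') \<in> doubles"
proof -
  have "crosses ?T x (1 - fst x, snd x)" if "x \<in> tovers ?T" for x
    using i that by (auto simp: crosses_def on_tangle_def bigon_def power2_eq_square)
  moreover have "crosses ?T' x (id x)" if "x \<in> tovers ?T'" for x
    using that by simp
  moreover have "on_tangle ?T x" if "x \<in> tbars ?T" for x
    using that by simp
  moreover have "on_tangle ?T' x" if "x \<in> tbars ?T'" for x
    using that by simp
  ultimately obtain Ps C B where Ps: "placements Ps" "length Ps = length (strands ?T)"
    and C: "finite C" "\<forall>c\<in>C. c \<inter> occupied Ps = {}" and B: "finite B" "B \<inter> occupied Ps = {}"
    and eq: "chords K = C \<union> tangle_chords Ps ?T (\<lambda>x. (1 - fst x, snd x))"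
      "chords K' = C \<union> tangle_chords Ps ?T' id"
      "base_bars K = B \<union> on_knot Ps ` tbars ?T" "base_bars K' = B \<union> on_knot Ps ` tbars ?T'"
    by (rule replaces_chords[OF K K' rep])
  have len: "0 < length Ps" "1 < length Ps"
    using Ps(2) by (simp_all add: bigon_def)
  define e where "e = {on_knot Ps (0, -1/2), on_knot Ps (1, -1/2)}"
  define f where "f = {on_knot Ps (0, 1/2), on_knot Ps (1, 1/2)}"
  have chK: "chords K = insert e (insert f C)"
    using i by (auto simp: eq e_def f_def insert_commute)
  have ef: "lk e d = lk f d" "lk d e = lk d f" if "d \<inter> occupied Ps = {}" for d
    unfolding e_def f_def by (rule lk_two_strands[OF Ps(1) len _ that]; simp)+
  have "e \<inter> occupied Ps \<noteq> {}" "f \<inter> occupied Ps \<noteq> {}"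
    using on_knot_occupied[OF len(1)] by (auto simp: e_def f_def)
  then have notin: "e \<notin> C" "f \<notin> C"
    using C(2) by blast+
  have "on_knot Ps (0, -1/2) \<notin> f"
    unfolding f_def using on_knot_eq_iff[OF Ps(1)] len by simp
  then have ne: "e \<noteq> f"
    unfolding e_def by blast
  have "link e f = link f e"
    using chK by (intro link_commute[OF K]) auto
  then have "lk e f = lk f e"
    using ne by (simp add: link_def)
  then have "chord_weight (insert e (insert f C)) B - chord_weight C B \<in> doubles"
    using C B ef notin ne by (intro chord_weight_twins) simp_all
  then show ?thesis
    unfolding chK by (simp add: eq)
qed

lemma C3_weight:
  assumes rep: "replaces (tangle_of (triangle 1) (triangle_overs h 1) {})
      (tangle_of (triangle (-1)) (triangle_overs h (-1)) {}) K K'" (is "replaces ?T ?T' K K'")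
  shows "chord_weight (chords K') (base_bars K') = chord_weight (chords K) (base_bars K)"
proof -
  have "crosses ?T x (triangle_partner 1 x)" if "x \<in> tovers ?T" for x
    using that by (intro triangle_crosses) simp_all
  moreover have "crosses ?T' x (triangle_partner (-1) x)" if "x \<in> tovers ?T'" for x
    using that by (intro triangle_crosses) simp_all
  moreover have "on_tangle ?T x" if "x \<in> tbars ?T" for x
    using that by simp
  moreover have "on_tangle ?T' x" if "x \<in> tbars ?T'" for x
    using that by simp
  ultimately obtain Ps C B where Ps: "placements Ps" "length Ps = length (strands ?T)"
    and C: "finite C" "\<forall>c\<in>C. c \<inter> occupied Ps = {}" and B: "finite B" "B \<inter> occupied Ps = {}"
    and eq: "chords K = C \<union> tangle_chords Ps ?T (triangle_partner 1)"
      "chords K' = C \<union> tangle_chords Ps ?T' (triangle_partner (-1))"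
    and bars: "base_bars K = B \<union> on_knot Ps ` tbars ?T" "base_bars K' = B \<union> on_knot Ps ` tbars ?T'"
    by (rule replaces_chords[OF K K' rep])
  have len: "0 < length Ps" "1 < length Ps" "2 < length Ps"
    using Ps(2) by (simp_all add: triangle_def diagonals_def)
  define x where "x = {on_knot Ps (0, 0), on_knot Ps (1, 0)}"
  define y where "y \<delta> = {on_knot Ps (0, \<delta>/2), on_knot Ps (2, \<delta>/2)}" for \<delta>
  define z where "z \<delta> = {on_knot Ps (1, -\<delta>/2), on_knot Ps (2, -\<delta>/2)}" for \<delta>
  have chK: "chords K = C \<union> {x, y 1, z 1}"
    unfolding eq(1) x_def y_def z_def by (subst triangle_chords) auto
  have chK': "chords K' = C \<union> {x, y (-1), z (-1)}"
    unfolding eq(2) x_def y_def z_def by (subst triangle_chords) auto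
  have "x \<inter> occupied Ps \<noteq> {}"
    using on_knot_occupied[OF len(1), of 0] by (auto simp: x_def)
  then have x: "x \<notin> C"
    using C(2) by blast
  have yz: "y \<delta> \<notin> C" "z \<delta> \<notin> C" "x \<noteq> y \<delta>" "x \<noteq> z \<delta>" "y \<delta> \<noteq> z \<delta>" if \<delta>: "\<delta> \<in> {1, -1}" for \<delta>
  proof -
    have half: "\<delta> / 2 \<in> {-1..1}" "- \<delta> / 2 \<in> {-1..1}" "\<delta> / 2 \<noteq> 0" "0 \<noteq> \<delta> / 2"
      using \<delta> by auto
    have "y \<delta> \<inter> occupied Ps \<noteq> {}" "z \<delta> \<inter> occupied Ps \<noteq> {}"
      using on_knot_occupied[OF len(1) half(1)] on_knot_occupied[OF len(2) half(2)]
      by (auto simp: y_def z_def)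
    then show "y \<delta> \<notin> C" "z \<delta> \<notin> C"
      using C(2) by blast+
    have "on_knot Ps (0, 0) \<notin> y \<delta>" "on_knot Ps (0, 0) \<notin> z \<delta>" "on_knot Ps (0, \<delta> / 2) \<notin> z \<delta>"
      unfolding y_def z_def using on_knot_eq_iff[OF Ps(1)] len half by simp_all
    then show "x \<noteq> y \<delta>" "x \<noteq> z \<delta>" "y \<delta> \<noteq> z \<delta>"
      by (auto simp: x_def y_def)
  qed
  have outer: "lk (y (-1)) d = lk (y 1) d" "lk (z (-1)) d = lk (z 1) d" "lk x d + lk (y 1) d + lk (z 1) d = 0"
    if d: "d \<inter> occupied Ps = {}" for d
  proof -
    show "lk (y (-1)) d = lk (y 1) d"
      unfolding y_def by (rule lk_two_strands[OF Ps(1) len(1,3) _ d]) simp_all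
    show "lk (z (-1)) d = lk (z 1) d"
      unfolding z_def by (rule lk_two_strands[OF Ps(1) len(2,3) _ d]) simp_all
    \<comment> \<open>All places are moved to parameter 0, after which each of the three strands
      occurs in two of the three chords.\<close>
    have "lk x d = lk {on_knot Ps (0, 0)} d + lk {on_knot Ps (1, 0)} d"
      unfolding x_def using on_knot_eq_iff[OF Ps(1)] len by (intro lk_pair) simp
    moreover have "lk (y 1) d = lk {on_knot Ps (0, 0), on_knot Ps (2, 0)} d"
      unfolding y_def by (rule lk_two_strands[OF Ps(1) len(1,3) _ d]) simp_all
    moreover have "\<dots> = lk {on_knot Ps (0, 0)} d + lk {on_knot Ps (2, 0)} d"
      using on_knot_eq_iff[OF Ps(1)] len by (intro lk_pair) simp
    moreover have "lk (z 1) d = lk {on_knot Ps (1, 0), on_knot Ps (2, 0)} d"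
      unfolding z_def by (rule lk_two_strands[OF Ps(1) len(2,3) _ d]) simp_all
    moreover have "\<dots> = lk {on_knot Ps (1, 0)} d + lk {on_knot Ps (2, 0)} d"
      using on_knot_eq_iff[OF Ps(1)] len by (intro lk_pair) simp
    ultimately show "lk x d + lk (y 1) d + lk (z 1) d = 0"
      by (simp add: add_ac)
  qed
  \<comment> \<open>Passing from \<delta> = 1 to \<delta> = -1 reverses the two crossings on the
    strand shared by each pair: strand 0 here, strand 1 for \<open>xz\<close> and strand 2 for
    \<open>yz_lk\<close>. The sets are rewritten below so that the shared strand comes
    first.\<close>
  have xy: "lk x (y (-1)) = lk x (y 1) + 1"
    unfolding x_def y_def by (rule lk_exchange[OF Ps(1) len]) simp_all
  have xz: "lk x (z (-1)) = lk x (z 1) + 1"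
    unfolding x_def z_def insert_commute[of "on_knot Ps (0, 0)"]
    by (rule lk_exchange[OF Ps(1) len(2,1,3)]) simp_all
  have yz_lk: "lk (y (-1)) (z (-1)) = lk (y 1) (z 1) + 1"
  proof -
    have y': "y \<delta> = {on_knot Ps (2, \<delta>/2), on_knot Ps (0, \<delta>/2)}"
      and z': "z \<delta> = {on_knot Ps (2, -\<delta>/2), on_knot Ps (1, -\<delta>/2)}" for \<delta>
      by (auto simp: y_def z_def)
    show ?thesis
      unfolding y' z' by (rule lk_exchange[OF Ps(1) len(3,1,2)]) simp_all
  qed
  have pos: "1 \<in> {1, -1 :: real}" and neg: "-1 \<in> {1, -1 :: real}"
    by simp_all
  note sym = link_commute[OF K, unfolded chK] link_commute[OF K', unfolded chK']
  have "chord_weight (C \<union> {x, y (-1), z (-1)}) B = chord_weight (C \<union> {x, y 1, z 1}) B"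
  proof (rule chord_weight_triangle[OF C(1) x yz(1,2)[OF pos] x yz(1,2)[OF neg] yz(3-5)[OF pos]
        yz(3-5)[OF neg] sym xy xz yz_lk])
    show "lk x c + lk (y 1) c + lk (z 1) c = 0" "lk (y (-1)) c = lk (y 1) c"
      "lk (z (-1)) c = lk (z 1) c" if "c \<in> C" for c
      using outer[of c] C(2) that by simp_all
    show "lk (y (-1)) B = lk (y 1) B" "lk (z (-1)) B = lk (z 1) B"
      using outer[of B] B(2) by simp_all
  qed simp_all
  then show ?thesis
    unfolding chK chK' by (simp add: bars)
qed

text \<open>Virtual crossings leave no trace among the chords, and a classical crossing in
  \<open>V4\<close> keeps its parameters, so the chord sets are literally equal.\<close>

lemma virtual_move_weight:
  assumes rep: "replaces T T' K K'" and same: "tovers T' = tovers T" "tbars T = {}" "tbars T' = {}"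
    and q: "\<And>x. x \<in> tovers T \<Longrightarrow> crosses T x (q x) \<and> crosses T' x (q x)"
  shows "chord_weight (chords K) (base_bars K) = chord_weight (chords K') (base_bars K')"
proof -
  have "crosses T x (q x)" if "x \<in> tovers T" for x
    using q that by simp
  moreover have "crosses T' x (q x)" if "x \<in> tovers T'" for x
    using q that same(1) by simp
  moreover have "on_tangle T x" if "x \<in> tbars T" for x
    using that same by simp
  moreover have "on_tangle T' x" if "x \<in> tbars T'" for x
    using that same by simp
  ultimately obtain Ps C B where "placements Ps" "length Ps = length (strands T)"
    "finite C" "\<forall>c\<in>C. c \<inter> occupied Ps = {}" "finite B" "B \<inter> occupied Ps = {}"
    and eq: "chords K = C \<union> tangle_chords Ps T q" "chords K' = C \<union> tangle_chords Ps T' q"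
      "base_bars K = B \<union> on_knot Ps ` tbars T" "base_bars K' = B \<union> on_knot Ps ` tbars T'"
    by (rule replaces_chords[OF K K' rep])
  then show ?thesis
    by (simp add: same)
qed

lemma no_chords_replaces:
  assumes rep: "replaces T T' K K'" and none: "tovers T = {}" "tovers T' = {}"
    and bars: "\<And>x. x \<in> tbars T \<Longrightarrow> on_tangle T x" "\<And>x. x \<in> tbars T' \<Longrightarrow> on_tangle T' x"
  obtains Ps C B where "placements Ps" "length Ps = length (strands T)"
    "\<forall>c\<in>C. c \<inter> occupied Ps = {}" "finite B" "B \<inter> occupied Ps = {}"
    "chords K = C" "chords K' = C"
    "base_bars K = B \<union> on_knot Ps ` tbars T" "base_bars K' = B \<union> on_knot Ps ` tbars T'"
proof -
  have "crosses T x (id x)" if "x \<in> tovers T" for x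
    using that none by simp
  moreover have "crosses T' x (id x)" if "x \<in> tovers T'" for x
    using that none by simp
  ultimately obtain Ps C B where Ps: "placements Ps" "length Ps = length (strands T)"
    and C: "finite C" "\<forall>c\<in>C. c \<inter> occupied Ps = {}" and B: "finite B" "B \<inter> occupied Ps = {}"
    and eq: "chords K = C \<union> tangle_chords Ps T id" "chords K' = C \<union> tangle_chords Ps T' id"
      "base_bars K = B \<union> on_knot Ps ` tbars T" "base_bars K' = B \<union> on_knot Ps ` tbars T'"
    using bars by (rule replaces_chords[OF K K' rep])
  have "chords K = C" "chords K' = C"
    using eq(1,2) none by simp_all
  then show thesis
    using that[OF Ps C(2) B] eq(3,4) by blast
qed

text \<open>No end of a chord lies between the two new bars, so they are on the same component of
  every smoothing.\<close>

lemma T1_weight: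
  assumes rep: "replaces (tangle_of line {} {}) (tangle_of line {} {(0, -1/2), (0, 1/2)}) K K'"
      (is "replaces ?T ?T' K K'")
  shows "chord_weight (chords K) (base_bars K) = chord_weight (chords K') (base_bars K')"
proof -
  have none: "tovers ?T = {}" "tovers ?T' = {}"
    by simp_all
  have "on_tangle ?T x" if "x \<in> tbars ?T" for x
    using that by simp
  moreover have "on_tangle ?T' x" if "x \<in> tbars ?T'" for x
    using that by (auto simp: on_tangle_def line_def)
  ultimately obtain Ps C B where Ps: "placements Ps" "length Ps = length (strands ?T)"
    and C: "\<forall>c\<in>C. c \<inter> occupied Ps = {}" and B: "finite B" "B \<inter> occupied Ps = {}"
    and eq: "chords K = C" "chords K' = C"
      "base_bars K = B \<union> on_knot Ps ` tbars ?T" "base_bars K' = B \<union> on_knot Ps ` tbars ?T'"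
    by (rule no_chords_replaces[OF rep none])
  have len: "0 < length Ps"
    using Ps(2) by (simp add: line_def)
  let ?X = "{on_knot Ps (0, -1/2), on_knot Ps (0, 1/2)}"
  have "?X \<subseteq> occupied Ps"
    using on_knot_occupied[OF len] by simp
  then have disj: "B \<inter> ?X = {}"
    using B(2) by blast
  have "on_knot Ps (0, -1/2) \<noteq> on_knot Ps (0, 1/2)"
    using on_knot_eq_iff[OF Ps(1) len len] by simp
  then have "card (B \<union> ?X) = card B + 2"
    using disj B(1) by (simp add: card_Un_disjoint)
  then have card: "(of_nat (card B) :: bit) = of_nat (card (B \<union> ?X))"
    by simp
  have "lk c B = lk c (B \<union> ?X)" if "c \<in> C" for c
  proof -
    have "lk c ?X = 0"
      using C that by (intro lk_same_strand[OF Ps(1) len]) simp_all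
    then show ?thesis
      using lk_Un_right[OF B(1) _ disj] by simp
  qed
  from chord_weight_bars_cong[OF this card] show ?thesis
    by (simp add: eq)
qed

lemma T2_weight:
  assumes i: "i \<in> {0, 1}"
    and rep: "replaces (tangle_of diagonals {} {(i, -1/2)}) (tangle_of diagonals {} {(i, 1/2)}) K K'"
      (is "replaces ?T ?T' K K'")
  shows "chord_weight (chords K) (base_bars K) = chord_weight (chords K') (base_bars K')"
proof -
  have none: "tovers ?T = {}" "tovers ?T' = {}"
    by simp_all
  have "on_tangle ?T x" if "x \<in> tbars ?T" for x
    using i that by (auto simp: on_tangle_def diagonals_def)
  moreover have "on_tangle ?T' x" if "x \<in> tbars ?T'" for x
    using i that by (auto simp: on_tangle_def diagonals_def)
  ultimately obtain Ps C B where Ps: "placements Ps" "length Ps = length (strands ?T)"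
    and C: "\<forall>c\<in>C. c \<inter> occupied Ps = {}" and B: "finite B" "B \<inter> occupied Ps = {}"
    and eq: "chords K = C" "chords K' = C"
      "base_bars K = B \<union> on_knot Ps ` tbars ?T" "base_bars K' = B \<union> on_knot Ps ` tbars ?T'"
    by (rule no_chords_replaces[OF rep none])
  have len: "i < length Ps"
    using Ps(2) i by (auto simp: diagonals_def)
  let ?x = "on_knot Ps (i, -1/2)" and ?y = "on_knot Ps (i, 1/2)"
  have "?x \<in> occupied Ps" "?y \<in> occupied Ps"
    using on_knot_occupied[OF len] by simp_all
  then have notin: "?x \<notin> B" "?y \<notin> B"
    using B(2) by blast+
  have card: "(of_nat (card (insert ?x B)) :: bit) = of_nat (card (insert ?y B))"
    using notin B(1) by simp
  have "lk c (insert ?x B) = lk c (insert ?y B)" if "c \<in> C" for c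
  proof -
    have "lk c {?x} = lk c {?y}"
      using C that by (intro lk_outside[OF len]) simp_all
    then show ?thesis
      unfolding lk_insert_right[OF B(1) notin(1)] lk_insert_right[OF B(1) notin(2)] by simp
  qed
  from chord_weight_bars_cong[OF this card] show ?thesis
    by (simp add: eq)
qed

text \<open>The chord at the crossing is unchanged. After smoothing there, either component holds
  one removed bar of each strand, so it loses two bars; an outside chord finds the two bars of a
  strand on the same side.\<close>

lemma T3_weight:
  assumes i: "i \<in> {0, 1}"
    and rep: "replaces (tangle_of diagonals {(i, 0)} ({0, 1} \<times> {-1/2, 1/2}))
             (tangle_of braid {(1 - i, 0)} {}) K K'"
      (is "replaces ?T ?T' K K'")
  shows "chord_weight (chords K) (base_bars K) = chord_weight (chords K') (base_bars K')"
proof -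
  have "crosses ?T x (1 - fst x, snd x)" if "x \<in> tovers ?T" for x
    using i that by (auto simp: crosses_def on_tangle_def diagonals_def)
  moreover have "crosses ?T' x (1 - fst x, snd x)" if "x \<in> tovers ?T'" for x
    using i that by (auto simp: crosses_def on_tangle_def braid_def)
  moreover have "on_tangle ?T x" if "x \<in> tbars ?T" for x
    using that by (auto simp: on_tangle_def diagonals_def)
  moreover have "on_tangle ?T' x" if "x \<in> tbars ?T'" for x
    using that by simp
  ultimately obtain Ps C B where Ps: "placements Ps" "length Ps = length (strands ?T)"
    and C: "finite C" "\<forall>c\<in>C. c \<inter> occupied Ps = {}" and B: "finite B" "B \<inter> occupied Ps = {}"
    and eq: "chords K = C \<union> tangle_chords Ps ?T (\<lambda>x. (1 - fst x, snd x))"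
      "chords K' = C \<union> tangle_chords Ps ?T' (\<lambda>x. (1 - fst x, snd x))"
      "base_bars K = B \<union> on_knot Ps ` tbars ?T" "base_bars K' = B \<union> on_knot Ps ` tbars ?T'"
    by (rule replaces_chords[OF K K' rep])
  have len: "0 < length Ps" "1 < length Ps"
    using Ps(2) by (simp_all add: diagonals_def)
  define e where "e = {on_knot Ps (0, 0), on_knot Ps (1, 0)}"
  define X where "X j = {on_knot Ps (j, -1/2), on_knot Ps (j, 1/2)}" for j
  have ch: "chords K = insert e C" "chords K' = insert e C"
    using i by (auto simp: eq e_def insert_commute)
  have bars: "base_bars K = B \<union> (X 0 \<union> X 1)" "base_bars K' = B"
    by (auto simp: eq X_def)
  have sub: "X j \<subseteq> strand Ps j" for j
    using on_knot_strand by (simp add: X_def)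
  have disj01: "X 0 \<inter> X 1 = {}"
    using sub[of 0] sub[of 1] strand_disjoint[OF Ps(1) len zero_neq_one] by blast
  have "strand Ps 0 \<subseteq> occupied Ps" "strand Ps 1 \<subseteq> occupied Ps"
    using len unfolding occupied_eq by blast+
  then have disj: "B \<inter> (X 0 \<union> X 1) = {}"
    using sub[of 0] sub[of 1] B(2) by blast
  have fin: "finite (X j)" for j
    by (simp add: X_def)
  have cardX: "card (X j) = 2" if "j < length Ps" for j
    using on_knot_eq_iff[OF Ps(1) that that] by (simp add: X_def)
  have card: "(of_nat (card (B \<union> (X 0 \<union> X 1))) :: bit) = of_nat (card B)"
    using disj disj01 fin B(1) cardX len by (simp add: card_Un_disjoint)
  have out: "lk c (X j) = 0" if "c \<in> C" "j < length Ps" for c j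
    unfolding X_def using C(2) that by (intro lk_same_strand[OF Ps(1) that(2)]) simp_all
  \<comment> \<open>Parameter 0 lies between -1/2 and 1/2 in whichever direction the knot runs, so
    exactly one bar comes after it.\<close>
  have own: "lk {on_knot Ps (j, 0)} (X j) = 1" if "j < length Ps" for j
  proof -
    have "on_knot Ps (j, -1/2) \<noteq> on_knot Ps (j, 1/2)"
      using on_knot_eq_iff[OF Ps(1) that that] by simp
    then show ?thesis
      unfolding X_def by (simp add: lk_pair(2)) (simp add: lk_def on_knot_less[OF Ps(1) that])
  qed
  have other: "lk {on_knot Ps (j, 0)} (X k) = 0" if "j < length Ps" "k < length Ps" "j \<noteq> k" for j k
  proof -
    have "lk {on_knot Ps (j, 0)} {on_knot Ps (k, -1/2)} = lk {on_knot Ps (j, 0)} {on_knot Ps (k, 1/2)}"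
      using that by (intro lk_other_strand[OF Ps(1)]) simp_all
    moreover have "on_knot Ps (k, -1/2) \<noteq> on_knot Ps (k, 1/2)"
      using on_knot_eq_iff[OF Ps(1) that(2) that(2)] by simp
    ultimately show ?thesis
      unfolding X_def by (simp add: lk_pair(2))
  qed
  have "lk e d = lk {on_knot Ps (0, 0)} d + lk {on_knot Ps (1, 0)} d" for d
    unfolding e_def using on_knot_eq_iff[OF Ps(1) len] by (intro lk_pair) simp
  then have "lk e (X 0) = 1" "lk e (X 1) = 1"
    using own[OF len(1)] own[OF len(2)] other[OF len] other[OF len(2,1)] by simp_all
  then have "lk c (X 0) + lk c (X 1) = 0" if "c \<in> insert e C" for c
    using that out[OF _ len(1)] out[OF _ len(2)] by auto
  then have "lk c (B \<union> (X 0 \<union> X 1)) = lk c B" if "c \<in> insert e C" for c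
    using that disj disj01 fin B(1) by (simp add: lk_Un_right)
  from chord_weight_bars_cong[OF this card] show ?thesis
    unfolding ch bars by blast
qed

lemma crossing_change_weight:
  assumes "crossing_change K K'"
  shows "chord_weight (chords K) (base_bars K) = chord_weight (chords K') (base_bars K')"
proof -
  obtain c where c: "c \<in> classical K" and curve: "curve K' = curve K" and bars: "bars K' = bars K"
    and overs: "overs K' = {t. if curve K t = c then t \<notin> overs K else t \<in> overs K}"
    using assms by (auto simp: crossing_change_def)
  \<comment> \<open>The former under passage becomes the over passage that keeps \<open>c\<close>
    classical.\<close>
  obtain t where "t \<in> {0..<1}" "t \<notin> overs K" "curve K t = c"
    using crossing_passages[OF K c] by metis
  then have "c \<in> classical K'"
    unfolding classical_iff[OF K'] using overs curve by auto
  moreover have "p \<in> classical K' \<longleftrightarrow> p \<in> classical K" if "p \<noteq> c" for p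
    unfolding classical_iff[OF K'] classical_iff[OF K] using that overs curve by auto
  ultimately have "p \<in> classical K' \<longleftrightarrow> p \<in> classical K" for p
    using c by (cases "p = c") simp_all
  then have "classical K' = classical K"
    by blast
  moreover have "fiber K' = fiber K"
    by (simp add: fiber_def curve fun_eq_iff)
  ultimately show ?thesis
    by (simp add: chords_def base_bars_def bars)
qed

end


section \<open>Planar isotopy\<close>

text \<open>A change of parameter cuts the circle open at another point.  This exchanges the two
  components at the crossings that have one passage on either side of the new cut.\<close>

definition shifted :: "(real \<Rightarrow> real) \<Rightarrow> real \<Rightarrow> real" where
  "shifted r t = frac (r t)"

text \<open>On \<open>{0..<1}\<close> the values of \<open>r\<close> fill a half-open interval of
  length 1, so the floor takes at most two values there; this bit tells which.\<close>

definition past_cut :: "(real \<Rightarrow> real) \<Rightarrow> real \<Rightarrow> bit" where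
  "past_cut r t = of_bool (\<lfloor>r t\<rfloor> \<noteq> \<lfloor>r 0\<rfloor>)"

context
  fixes r :: "real \<Rightarrow> real"
  assumes r: "reparametrization r"
begin

lemma reparametrization_has_derivative: "(r has_real_derivative deriv r t) (at t)"
proof -
  have "r differentiable at t"
    using r by (simp add: reparametrization_def C1_differentiable_on_eq)
  then show ?thesis
    by (simp add: DERIV_deriv_iff_real_differentiable)
qed

lemma reparametrization_less_iff: "r s < r t \<longleftrightarrow> s < t"
proof -
  have pos: "deriv r u > 0" for u
    using r unfolding reparametrization_def by blast
  have "r s < r t" if "s < t" for s t
    by (rule DERIV_pos_imp_increasing[OF that]) (use reparametrization_has_derivative pos in blast)
  then show ?thesis
    by (metis less_asym linorder_cases)
qed

lemma reparametrization_range: "t \<in> {0..<1} \<Longrightarrow> r 0 \<le> r t \<and> r t < r 0 + 1"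
proof -
  assume t: "t \<in> {0..<1}"
  have "r (0 + 1) = r 0 + 1"
    using r unfolding reparametrization_def by blast
  then show ?thesis
    using t reparametrization_less_iff[of t 0] reparametrization_less_iff[of t 1] by auto
qed

text \<open>As \<open>r\<close> is increasing, taking fractional parts reverses precisely the pairs
  with one point on either side of the new cut.\<close>

lemma less_shifted:
  assumes "s \<in> {0..<1}" "t \<in> {0..<1}" "s \<noteq> t"
  shows "of_bool (shifted r s < shifted r t) = of_bool (s < t) + past_cut r s + past_cut r t"
proof -
  have fl: "\<lfloor>r u\<rfloor> = \<lfloor>r 0\<rfloor> \<or> \<lfloor>r u\<rfloor> = \<lfloor>r 0\<rfloor> + 1" if "u \<in> {0..<1}" for u
    using reparametrization_range[OF that] by linarith
  have shifted_floor: "shifted r u = r u - \<lfloor>r u\<rfloor>" for u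
    by (simp add: shifted_def frac_def)
  have near: "\<bar>r s - r t\<bar> < 1"
    using reparametrization_range[OF assms(1)] reparametrization_range[OF assms(2)] by linarith
  consider "\<lfloor>r s\<rfloor> = \<lfloor>r t\<rfloor>" | "\<lfloor>r s\<rfloor> = \<lfloor>r 0\<rfloor>" "\<lfloor>r t\<rfloor> = \<lfloor>r 0\<rfloor> + 1"
    | "\<lfloor>r s\<rfloor> = \<lfloor>r 0\<rfloor> + 1" "\<lfloor>r t\<rfloor> = \<lfloor>r 0\<rfloor>"
    using fl[OF assms(1)] fl[OF assms(2)] by argo
  then show ?thesis
  proof cases
    case 1
    then show ?thesis
      using reparametrization_less_iff[of s t] by (simp add: shifted_floor past_cut_def add.assoc)
  next
    case 2
    then have "r s < r t"
      by linarith
    then have "s < t" "\<not> shifted r s < shifted r t"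
      using reparametrization_less_iff[of s t] near 2 by (simp_all add: shifted_floor)
    then show ?thesis
      using 2 by (simp add: past_cut_def)
  next
    case 3
    then have "r t < r s"
      by linarith
    then have "\<not> s < t" "shifted r s < shifted r t"
      using reparametrization_less_iff[of t s] near 3 by (simp_all add: shifted_floor)
    then show ?thesis
      using 3 by (simp add: past_cut_def)
  qed
qed

lemma inj_shifted: "inj_on (shifted r) {0..<1}"
proof (rule inj_onI)
  fix s t assume st: "s \<in> {0..<1}" "t \<in> {0..<1}" and eq: "shifted r s = shifted r t"
  show "s = t"
  proof (rule ccontr)
    assume ne: "s \<noteq> t"
    \<comment> \<open>With equal images both strict comparisons fail, so \<open>less_shifted\<close>
      makes both sides 0; but only one of \<open>s < t\<close> and \<open>t < s\<close>
      holds.\<close>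
    have "of_bool (s < t) + past_cut r s + past_cut r t = of_bool (t < s) + past_cut r t + past_cut r s"
      using less_shifted[OF st ne] less_shifted[OF st(2,1)] ne eq by simp
    then show False
      using ne by (cases "s < t") (auto simp: add_ac)
  qed
qed

lemma shifted_surj:
  assumes "y \<in> {0..<1}"
  obtains t where "t \<in> {0..<1}" "shifted r t = y"
proof -
  \<comment> \<open>The integer translate of \<open>y\<close> that falls into the period starting at
    \<open>r 0\<close>.\<close>
  define n where "n = \<lceil>r 0 - y\<rceil>"
  have n: "r 0 \<le> y + n" "y + n < r 0 + 1"
    unfolding n_def by linarith+
  have r1: "r 1 = r 0 + 1"
    using r unfolding reparametrization_def by (metis add_0)
  have "continuous_on {0..1} r"
    using reparametrization_has_derivative DERIV_isCont continuous_at_imp_continuous_on by blast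
  then obtain t where t: "0 \<le> t" "t \<le> 1" "r t = y + n"
    using IVT'[of r 0 "y + n" 1] n r1 by auto
  then have "t \<noteq> 1"
    using n r1 by auto
  then have "t \<in> {0..<1}"
    using t by simp
  moreover have "shifted r t = y"
    using assms by (simp add: shifted_def t(3) frac_def floor_eq_iff)
  ultimately show thesis
    using that by blast
qed

lemma shifted_image: "shifted r ` {0..<1} = {0..<1}"
proof
  show "shifted r ` {0..<1} \<subseteq> {0..<1}"
    unfolding shifted_def by (auto simp: frac_lt_1)
  show "{0..<1} \<subseteq> shifted r ` {0..<1}"
  proof
    fix y :: real assume "y \<in> {0..<1}"
    then obtain t where "t \<in> {0..<1}" "shifted r t = y"
      by (rule shifted_surj)
    then show "y \<in> shifted r ` {0..<1}"
      by blast
  qed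
qed

lemma shifted_image_Collect: "shifted r ` {t \<in> {0..<1}. Q (shifted r t)} = {u \<in> {0..<1}. Q u}"
proof -
  have "shifted r ` {t \<in> {0..<1}. Q (shifted r t)} = {u \<in> shifted r ` {0..<1}. Q u}"
    by blast
  then show ?thesis
    by (simp only: shifted_image)
qed

text \<open>Between two chords both corrections vanish, as the cardinalities are even. Between a
  chord and the bars only a multiple of the number of bars remains, which at most exchanges the two
  components.\<close>

lemma lk_shifted:
  assumes "c \<subseteq> {0..<1}" "d \<subseteq> {0..<1}" "c \<inter> d = {}"
  shows "lk (shifted r ` c) (shifted r ` d) =
    lk c d + of_nat (card d) * (\<Sum>x\<in>c. past_cut r x) + of_nat (card c) * (\<Sum>y\<in>d. past_cut r y)"
proof -
  have "lk (shifted r ` c) (shifted r ` d) = (\<Sum>x\<in>c. \<Sum>y\<in>d. of_bool (shifted r x < shifted r y))"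
    unfolding lk_def using inj_on_subset[OF inj_shifted assms(1)] inj_on_subset[OF inj_shifted assms(2)]
    by (simp add: sum.reindex)
  also have "\<dots> = (\<Sum>x\<in>c. \<Sum>y\<in>d. of_bool (x < y) + past_cut r x + past_cut r y)"
    using assms by (intro sum.cong refl less_shifted) auto
  also have "\<dots> = lk c d + of_nat (card d) * (\<Sum>x\<in>c. past_cut r x) + of_nat (card c) * (\<Sum>y\<in>d. past_cut r y)"
    by (simp add: lk_def sum.distrib sum_distrib_left)
  finally show ?thesis .
qed

end

text \<open>Since \<open>H 1\<close> is injective, it preserves which parameters share a point. The
  change of the chords is thus due to \<open>?\<rho>\<close> alone, which carries the parameters of
  \<open>K'\<close> to those of \<open>K\<close>.\<close>

lemma isotopy_weight:
  assumes K: "twisted_diagram K" "twisted_diagram K'" and iso: "planar_isotopic K K'"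
  shows "chord_weight (chords K) (base_bars K) = chord_weight (chords K') (base_bars K')"
proof -
  obtain H r where H: "ambient_isotopy H" and r: "reparametrization r"
    and K': "curve K' = H 1 \<circ> curve K \<circ> r" "overs K' = r -` overs K" "bars K' = r -` bars K"
    using iso by (auto simp: planar_isotopic_def)
  let ?\<rho> = "shifted r"
  have "inj (H 1)"
    using H by (simp add: ambient_isotopy_def bij_def)
  then have curve: "curve K' t = H 1 q \<longleftrightarrow> curve K (?\<rho> t) = q" for t q
    by (simp add: K' shifted_def curve_frac[OF K(1)] inj_eq)
  have overs: "t \<in> overs K' \<longleftrightarrow> ?\<rho> t \<in> overs K" for t
    by (simp add: K' shifted_def overs_frac[OF K(1)])
  have bars: "t \<in> bars K' \<longleftrightarrow> ?\<rho> t \<in> bars K" for t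
    unfolding K' shifted_def vimage_eq
    by (rule periodic_frac[where f = "\<lambda>t. t \<in> bars K", symmetric]) (rule bars_periodic[OF K(1)])
  have fiber: "?\<rho> ` fiber K' (H 1 q) = fiber K q" for q
    unfolding fiber_def curve by (rule shifted_image_Collect[OF r])
  have base_bars: "?\<rho> ` base_bars K' = base_bars K"
    using shifted_image_Collect[OF r, of "\<lambda>t. t \<in> bars K"]
    by (simp add: base_bars_def bars Int_def conj_commute)
  have "classical K' = H 1 ` classical K"
  proof (intro equalityI subsetI)
    fix p assume "p \<in> classical K'"
    then show "p \<in> H 1 ` classical K"
      by (auto simp: classical_def K')
  next
    fix p assume "p \<in> H 1 ` classical K"
    then obtain u where u: "u \<in> {0..<1}" "u \<in> overs K" "p = H 1 (curve K u)"
      using classical_iff[OF K(1)] by auto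
    then obtain t where "t \<in> {0..<1}" "?\<rho> t = u"
      using shifted_surj[OF r] by metis
    then show "p \<in> classical K'"
      unfolding classical_iff[OF K(2)] using u overs curve by metis
  qed
  then have chords: "(`) ?\<rho> ` chords K' = chords K"
    by (simp add: chords_def image_image fiber)
  have sub: "c \<subseteq> {0..<1}" if "c \<in> chords K'" for c
    using that by (auto simp: chords_def fiber_def)
  have inj: "inj_on ((`) ?\<rho>) (chords K')"
    using inj_on_image[OF inj_on_subset[OF inj_shifted[OF r]], of "chords K'"] sub by auto
  have card: "card (base_bars K') = card (base_bars K)"
    using card_image[OF inj_on_subset[OF inj_shifted[OF r]], of "base_bars K'"]
    by (simp add: base_bars) (simp add: base_bars_def)
  have link: "link (?\<rho> ` c) (?\<rho> ` d) = link c d" if "c \<in> chords K'" "d \<in> chords K'" for c d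
  proof (cases "c = d")
    case False
    then have "?\<rho> ` c \<noteq> ?\<rho> ` d"
      using inj that by (auto dest: inj_onD)
    moreover have "lk (?\<rho> ` c) (?\<rho> ` d) = lk c d"
      using lk_shifted[OF r sub sub chords_disjoint[OF K(2)]] that False
        chord_finite_card[OF K(2)] by simp
    ultimately show ?thesis
      using False by (simp add: link_def)
  qed simp
  have lk: "lk (?\<rho> ` c) (base_bars K) = lk c (base_bars K') \<or>
      lk (?\<rho> ` c) (base_bars K) = lk c (base_bars K') + of_nat (card (base_bars K))"
    if "c \<in> chords K'" for c
  proof -
    have "c \<inter> base_bars K' = {}"
      using chord_disjoint_bars[OF K(2) that] .
    then have "lk (?\<rho> ` c) (base_bars K) =
        lk c (base_bars K') + of_nat (card (base_bars K)) * (\<Sum>x\<in>c. past_cut r x)"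
      using lk_shifted[OF r sub[OF that], of "base_bars K'"] chord_finite_card[OF K(2) that]
      by (simp add: base_bars card) (simp add: base_bars_def)
    then show ?thesis
      by (cases "\<Sum>x\<in>c. past_cut r x") auto
  qed
  show ?thesis
    unfolding chord_weight_def card
    by (rule weight_iso[where \<phi> = "(`) ?\<rho>"]) (simp_all add: bij_betw_def inj chords link lk)
qed


section \<open>Homotopy\<close>

lemma move_weight:
  assumes K: "twisted_diagram K" "twisted_diagram K'" and "move K K'"
  shows "chord_weight (chords K) (base_bars K) - chord_weight (chords K') (base_bars K') \<in> doubles"
proof -
  have eq: ?thesis if "chord_weight (chords K) (base_bars K) = chord_weight (chords K') (base_bars K')"
    using that doubles.zero by simp
  from assms(3) show ?thesis
  proof cases
    case isotopy
    then show ?thesis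
      by (rule eq[OF isotopy_weight[OF K]])
  next
    case (C1 v)
    then show ?thesis
      by (rule eq[OF C1_weight[OF K]])
  next
    case (C2 i)
    then show ?thesis
      by (rule C2_weight[OF K])
  next
    case (C3 h)
    then show ?thesis
      using eq[OF C3_weight[OF K, symmetric]] by blast
  next
    case V1
    then show ?thesis
      by (rule eq[OF virtual_move_weight[OF K, where q = id]]) simp_all
  next
    case V2
    then show ?thesis
      by (rule eq[OF virtual_move_weight[OF K, where q = id]]) simp_all
  next
    case V3
    then show ?thesis
      by (rule eq[OF virtual_move_weight[OF K, where q = id]]) simp_all
  next
    case (V4 i)
    show ?thesis
      by (rule eq[OF virtual_move_weight[OF K V4(2), where q = "\<lambda>x. (1 - fst x, snd x)"]])
        (use V4(1) in \<open>auto simp: crosses_def on_tangle_def triangle_def diagonals_def\<close>)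
  next
    case T1
    then show ?thesis
      by (rule eq[OF T1_weight[OF K]])
  next
    case (T2 i)
    then show ?thesis
      by (rule eq[OF T2_weight[OF K]])
  next
    case (T3 i)
    then show ?thesis
      by (rule eq[OF T3_weight[OF K]])
  qed
qed

lemma homotopic_Qz:
  assumes "homotopic_diagrams K K'"
  shows "Qz K - Qz K' \<in> doubles"
  using assms unfolding homotopic_diagrams_def
proof (induction rule: equivclp_induct)
  case base
  show ?case by (simp add: doubles.zero)
next
  case (step L L')
  have *: "Qz L - Qz L' \<in> doubles" if "reidemeister L L' \<or> crossing_change L L'" for L L'
  proof -
    have L: "twisted_diagram L" "twisted_diagram L'"
      using that by (auto simp: reidemeister_def crossing_change_def)
    have "chord_weight (chords L) (base_bars L) - chord_weight (chords L') (base_bars L') \<in> doubles"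
      using that
    proof
      assume "reidemeister L L'"
      then show ?thesis
        using move_weight[OF L] by (simp add: reidemeister_def)
    next
      assume "crossing_change L L'"
      then show ?thesis
        using crossing_change_weight[OF L] by (simp add: doubles.zero)
    qed
    from doubles_add[OF doubles_add[OF Qz_weight[OF L(1)] this] doubles_uminus[OF Qz_weight[OF L(2)]]]
    show ?thesis
      by simp
  qed
  have "Qz L - Qz L' \<in> doubles"
    using step.hyps(2)
  proof
    assume "reidemeister L' L \<or> crossing_change L' L"
    from doubles_uminus[OF *[OF this]] show ?thesis
      by simp
  qed (rule *)
  from doubles_add[OF step.IH this] show ?case
    by simp
qed

text \<open>This makes the choice of diagrams immaterial: \<open>homotopic_knots\<close> only
  provides one related pair of representatives.\<close>

lemma twisted_knot_homotopic:
  assumes "k \<in> twisted_knots" "K \<in> k" "L \<in> k"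
  shows "homotopic_diagrams K L"
proof -
  obtain x where "equivclp reidemeister x K" "equivclp reidemeister x L"
    using assms by (auto simp: twisted_knots_def quotient_def twisted_equivalence_def)
  then have "equivclp reidemeister K L"
    by (blast intro: equivclp_trans[OF equivclp_sym])
  then show ?thesis
    unfolding homotopic_diagrams_def
  proof (induction rule: equivclp_induct)
    case (step L L')
    show ?case
      by (rule equivclp_into_equivclp[OF step.IH]) (use step.hyps(2) in blast)
  qed simp
qed

theorem theorem6p2:
  fixes k k' :: "diagram set" and K K' :: diagram
  assumes "k \<in> twisted_knots" and "k' \<in> twisted_knots" and "homotopic_knots k k'"
    and "K \<in> k" and "K' \<in> k'"
  shows "\<exists>(m :: nat) (a :: nat \<Rightarrow> int) (b :: nat \<Rightarrow> nat) (p0 :: nat \<Rightarrow> nat) (p1 :: nat \<Rightarrow> nat).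
    (\<forall>i \<in> {1..m}. a i \<in> {-1, 1} \<and> b i \<in> {0, 1} \<and> p0 i \<in> {0, 1} \<and> p1 i \<in> {0, 1}) \<and>
    Qz K - Qz K' =
      (\<Sum>i = 1..m. 2 * of_int (a i) * (s_var ^ b i * t_var ^ p0 i - 1) *
         (s_var ^ b i * t_var ^ p1 i - 1))"
proof -
  obtain L L' where L: "L \<in> k" "L' \<in> k'" "homotopic_diagrams L L'"
    using assms(3) by (auto simp: homotopic_knots_def)
  have "homotopic_diagrams K L" "homotopic_diagrams L' K'"
    using twisted_knot_homotopic assms L by blast+
  then have "homotopic_diagrams K K'"
    using L(3) unfolding homotopic_diagrams_def by (blast intro: equivclp_trans)
  then show ?thesis
    by (intro doubles_as_sum homotopic_Qz)
qed

end
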